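(* Let $k\ge 0$. For all $(m,n)\in U_k$: (1) if $n=f_{2k+3}-1$, then $H_{m,n}=(-1)^{k+1}(-1)^{\frac{f_{2k+5}}{2}-\Phi_{k+1}(m+n)}\cdot\frac{f_{2k+1}}{2}$; (2) if $n=f_{2k}$, then $H_{m,n}=(-1)^{k+1}(-1)^{\frac{f_{2k+2}-1}{2}}\cdot\frac{f_{2k+1}}{2}$; (3) if $f_{2k}<n<f_{2k+3}-1$, then: if $m+n=\alpha_i-f_{2k+2}+1$ or $m+n=\alpha_i$ for some $i\ge 1$, we have \[H_{m,n}=-(-1)^{(f_{2k+3}-n)k}(-1)^{\frac{(f_{2k+3}-1-n)(f_{2k+3}-2-n)}{2}}\cdot\frac{f_{2k+1}}{2};\] otherwise $H_{m,n}=0$.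
   Context: Let $\tau$ be the substitution on $\{0,1\}$ with $\tau(1)=101$, $\tau(0)=1$ (extended to words by concatenation), and let $\mathbf{s}=(s_j)_{j\ge 0}=\lim_{j\to\infty}\tau^j(1)$ be its fixed point beginning with $1$. For $m\ge 0$, $n\ge 1$, $H_{m,n}=\det(s_{m+i+j})_{0\le i,j\le n-1}$. Define $f_{2j}=|\tau^j(1)|$, $f_{2j+1}=|\tau^j(10)|$ ($|w|$ = length of $w$); equivalently $f_0=1$, $f_1=2$, $f_{2j+2}=f_{2j}+f_{2j+1}$, $f_{2j+3}=f_{2j}+f_{2j+2}$, giving $(1,2,3,4,7,10,17,24,41,\dots)$; the $f_{2j+1}$ are even and the $f_{2j}$ odd. Every integer $n\ge0$ has a unique representation $n=\sum_{i\ge0}a_i(n)f_i$ with $a_i(n)\in\{0,1\}$, finitely many nonzero, $a_ia_{i+1}=0$ for all $i$, and $a_ia_{i+2}=0$ for all even $i$. For $k\ge0$ put $\Phi_k(n)=\sum_{i=0}^{2k+2}a_i(n)f_i$. Let $\mathbb{N}=\{0,1,2,\dots\}$. For $k\ge 0$ let $E'_{k}=\{x\in\mathbb{N}:\Phi_k(x)=f_{2k+3}/2\}$, $F_k=\{y\in\mathbb{N}:\Phi_k(y)=f_{2k+1}/2\}$, $F'_k=\{y\in\mathbb{N}:\Phi_{k+1}(y)=f_{2k+1}/2\}$, $F''_k=F_k\setminus F'_k$. For fixed $k$, let $(\alpha_i)_{i\ge1}$, $(\beta'_i)_{i\ge1}$, $(\gamma_i)_{i\ge1}$ be the increasing enumerations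 of $E'_{k+1}$, $F''_k$, $E'_k$ respectively, and $\beta_i=\beta'_i+f_{2k}$. For $i\ge1$ define $U_{k,i}=\{(m,n)\in\mathbb{N}^2: f_{2k}\le n<f_{2k+3},\ \alpha_i-f_{2k+2}<n+m\le\alpha_i\}$, $V_{k,i}=\{(m,n)\in\mathbb{N}^2: f_{2k}\le n<f_{2k+2},\ \beta_i<n+m\le\beta_i+f_{2k+1}\}$, $T_{k,i}=\{(m,n)\in\mathbb{N}^2: f_{2k+1}\le n<f_{2k+2},\ \gamma_i-f_{2k}<n+m\le\gamma_i\}$, and $U_k=\bigcup_{i\ge1}U_{k,i}$, $V_k=\bigcup_{i\ge1}V_{k,i}$, $T_k=\bigcup_{i\ge1}T_{k,i}$. *)

theory Defs
  imports "Jordan_Normal_Form.Determinant" "HOL-Library.Infinite_Set"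
begin

definition tau_letter :: "nat \<Rightarrow> nat list" where
  "tau_letter c = (if c = 1 then [1, 0, 1] else [1])"

definition tau :: "nat list \<Rightarrow> nat list" where
  "tau w = concat (map tau_letter w)"

text \<open>
  The word \<open>(tau ^^ j) [1]\<close> is a prefix of \<open>(tau ^^ N) [1]\<close> for \<open>j \<le> N\<close> and is
  longer than \<open>j\<close>, so the limit word can be read off as follows; the
  lemma \<open>s_limit\<close> below confirms this.
\<close>

definition s :: "nat \<Rightarrow> nat" where
  "s j = (tau ^^ j) [1] ! j"

lemma tau_append: "tau (u @ v) = tau u @ tau v"
  by (simp add: tau_def)

lemma tau_pow_append: "(tau ^^ j) (u @ v) = (tau ^^ j) u @ (tau ^^ j) v"
  by (induction j) (simp_all add: tau_append)

lemma length_tau: "length w \<le> length (tau w)"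
  by (induction w) (auto simp: tau_def tau_letter_def)

lemma length_tau_pow: "length w \<le> length ((tau ^^ j) w)"
  by (induction j) (auto intro: order_trans length_tau)

lemma tau_pow_Suc_1: "(tau ^^ Suc j) [1] = (tau ^^ j) [1] @ (tau ^^ j) [0, 1]"
proof -
  have "(tau ^^ Suc j) [1] = (tau ^^ j) (tau [1])"
    by (simp only: funpow_Suc_right o_apply)
  also have "tau [1] = [1] @ [0, 1]"
    by (simp add: tau_def tau_letter_def)
  finally show ?thesis
    by (simp only: tau_pow_append)
qed

lemma tau_pow_1_longer: "j < length ((tau ^^ j) [1])"
proof (induction j)
  case (Suc j)
  have "length [0, 1::nat] \<le> length ((tau ^^ j) [0, 1])"
    by (rule length_tau_pow)
  then have "0 < length ((tau ^^ j) [0, 1])"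
    unfolding list.size by linarith
  then show ?case
    unfolding tau_pow_Suc_1 length_append using Suc by linarith
qed simp

lemma s_limit:
  assumes "j \<le> N"
  shows "j < length ((tau ^^ N) [1])" and "(tau ^^ N) [1] ! j = s j"
proof -
  show "j < length ((tau ^^ N) [1])"
    using assms tau_pow_1_longer by (rule le_less_trans)
  show "(tau ^^ N) [1] ! j = s j"
    using assms
  proof (induction N rule: dec_induct)
    case base
    show ?case by (simp add: s_def)
  next
    case (step N)
    have "j < length ((tau ^^ N) [1])"
      using step.hyps(1) tau_pow_1_longer by (rule le_less_trans)
    then show ?case
      unfolding tau_pow_Suc_1 using step.IH by (simp add: nth_append)
  qed
qed

definition H :: "nat \<Rightarrow> nat \<Rightarrow> int" where
  "H m n = det (mat n n (\<lambda>(i, j). int (s (m + i + j))))"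

definition f :: "nat \<Rightarrow> nat" where
  "f i = length ((tau ^^ (i div 2)) (if even i then [1] else [1, 0]))"

lemma f_0: "f 0 = 1" and f_1: "f 1 = 2"
  by (simp_all add: f_def)

lemma f_even_rec: "f (2 * j + 2) = f (2 * j) + f (2 * j + 1)"
proof -
  have "f (2 * j + 2) = length ((tau ^^ Suc j) [1])"
    by (simp add: f_def)
  also have "(tau ^^ Suc j) [1] = (tau ^^ j) (tau [1])"
    by (simp only: funpow_Suc_right o_apply)
  also have "tau [1] = [1, 0] @ [1]"
    by (simp add: tau_def tau_letter_def)
  finally show ?thesis
    unfolding tau_pow_append by (simp add: f_def)
qed

lemma f_odd_rec: "f (2 * j + 3) = f (2 * j) + f (2 * j + 2)"
proof -
  have "(2 * j + 3) div 2 = Suc j"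
    by simp
  then have "f (2 * j + 3) = length ((tau ^^ Suc j) ([1] @ [0]))"
    by (simp add: f_def)
  also have "\<dots> = length ((tau ^^ Suc j) [1]) + length ((tau ^^ Suc j) [0])"
    by (simp only: tau_pow_append length_append)
  also have "(tau ^^ Suc j) [0] = (tau ^^ j) (tau [0])"
    by (simp only: funpow_Suc_right o_apply)
  also have "tau [0] = [1]"
    by (simp add: tau_def tau_letter_def)
  finally show ?thesis
    by (simp add: f_def)
qed

text \<open>By the parities below, the halves \<open>f (2 * j + 1) div 2\<close> and
  \<open>(f (2 * j) - 1) div 2\<close> are exact.\<close>

lemma f_parity: "odd (f (2 * j)) \<and> even (f (2 * j + 1))"
proof (induction j)
  case (Suc j)
  then show ?case
    using f_even_rec[of j] f_odd_rec[of j] by (simp add: numeral_3_eq_3)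
qed (simp add: f_def)

definition is_representation :: "(nat \<Rightarrow> nat) \<Rightarrow> nat \<Rightarrow> bool" where
  "is_representation a n \<longleftrightarrow>
     (\<forall>i. a i \<in> {0, 1}) \<and> finite {i. a i \<noteq> 0} \<and>
     (\<forall>i. a i * a (i + 1) = 0) \<and> (\<forall>i. even i \<longrightarrow> a i * a (i + 2) = 0) \<and>
     n = (\<Sum>i | a i \<noteq> 0. a i * f i)"

definition digit :: "nat \<Rightarrow> nat \<Rightarrow> nat" where
  "digit n = (THE a. is_representation a n)"

definition Phi :: "nat \<Rightarrow> nat \<Rightarrow> nat" where
  "Phi k n = (\<Sum>i\<le>2 * k + 2. digit n i * f i)"

definition E' :: "nat \<Rightarrow> nat set" where
  "E' k = {x. Phi k x = f (2 * k + 3) div 2}"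

text \<open>\<open>alpha k i\<close> is meant for \<open>i \<ge> 1\<close>; \<open>enumerate\<close> counts from \<open>0\<close>.\<close>

definition alpha :: "nat \<Rightarrow> nat \<Rightarrow> nat" where
  "alpha k i = enumerate (E' (k + 1)) (i - 1)"

definition U_part :: "nat \<Rightarrow> nat \<Rightarrow> (nat \<times> nat) set" where
  "U_part k i = {(m, n). f (2 * k) \<le> n \<and> n < f (2 * k + 3) \<and>
     int (alpha k i) - int (f (2 * k + 2)) < int (n + m) \<and> n + m \<le> alpha k i}"

definition U :: "nat \<Rightarrow> (nat \<times> nat) set" where
  "U k = (\<Union>i\<in>{1..}. U_part k i)"

end

theory Submission
  imports Defs "HOL-Number_Theory.Cong"
begin

text \<open>
  Let \<open>A = tau ^ k (1)\<close> and \<open>B = tau ^ k (0)\<close> have lengths \<open>p\<close> and \<open>q\<close>. Every element of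
  \<open>E' (k + 1)\<close> exceeds by \<open>f (2 * k + 5) / 2\<close> the position of a block \<open>tau ^ (k + 2) (1) = ABAAABA\<close>
  of \<open>s\<close>. As \<open>AB\<close> and \<open>BA\<close> differ in just two adjacent
  positions, the factor \<open>AAA\<close> extends to a maximal run of period \<open>p\<close> and length \<open>4 * p + q - 2\<close>, and at
  both ends of the run the difference \<open>s (j + p) - s j\<close> is a sign.

  Subtract from each row of the Hankel matrix, except the first \<open>p\<close>, the row \<open>p\<close> places above. Inside
  the window \<open>U k\<close> this creates a zero row. On its frame, the new rows form two antitriangular blocks
  with these signs on their antidiagonals, and they leave the \<open>p\<close> by \<open>p\<close> Hankel matrix of the
  \<open>p\<close>-periodic word \<open>AAA...\<close>. That matrix is circulant. Shifting the cyclic word \<open>A\<close> by \<open>q\<close> again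
  only swaps two adjacent letters, whence its determinant is, up to sign, the number
  \<open>f (2 * k + 1) / 2\<close> of ones in \<open>A\<close>.
\<close>

subsection \<open>Determinants with antitriangular blocks\<close>

abbreviation detf :: "nat \<Rightarrow> (nat \<Rightarrow> nat \<Rightarrow> int) \<Rightarrow> int" where
  "detf n G \<equiv> det (mat n n (\<lambda>(i, j). G i j))"

lemma detf_cong:
  assumes "\<And>i j. i < n \<Longrightarrow> j < n \<Longrightarrow> G i j = G' i j"
  shows "detf n G = detf n G'"
  by (rule arg_cong[of _ _ det], rule eq_matI) (auto simp: assms)

lemma detf_mult:
  "detf n (\<lambda>i j. \<Sum>l<n. F i l * G l j) = detf n F * detf n G"
proof -
  have "mat n n (\<lambda>(i, j). F i j) * mat n n (\<lambda>(i, j). G i j) =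
      mat n n (\<lambda>(i, j). \<Sum>l<n. F i l * G l j)"
    by (rule eq_matI) (auto simp: scalar_prod_def atLeast0LessThan)
  then show ?thesis
    by (metis det_mult mat_carrier)
qed

lemma detf_upper_triangular:
  assumes "\<And>i j. j < i \<Longrightarrow> i < n \<Longrightarrow> G i j = 0"
  shows "detf n G = (\<Prod>i<n. G i i)"
proof -
  have "detf n G = prod_list (diag_mat (mat n n (\<lambda>(i, j). G i j)))"
    by (rule det_upper_triangular[of _ n]) (auto simp: upper_triangular_def assms)
  then show ?thesis
    by (simp add: prod_list_diag_prod atLeast0LessThan)
qed

lemma detf_lower_triangular:
  assumes "\<And>i j. i < j \<Longrightarrow> j < n \<Longrightarrow> G i j = 0"
  shows "detf n G = (\<Prod>i<n. G i i)"
proof -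
  have "detf n G = prod_list (diag_mat (mat n n (\<lambda>(i, j). G i j)))"
    by (rule det_lower_triangular[of n]) (auto simp: assms)
  then show ?thesis
    by (simp add: prod_list_diag_prod atLeast0LessThan)
qed

lemma detf_zero_row:
  assumes "i < n" and "\<And>j. j < n \<Longrightarrow> G i j = 0"
  shows "detf n G = 0"
proof -
  have "detf n G = (\<Sum>j<n. mat n n (\<lambda>(i, j). G i j) $$ (i, j) *
      cofactor (mat n n (\<lambda>(i, j). G i j)) i j)"
    using assms(1) by (intro laplace_expansion_row) auto
  then show ?thesis
    using assms by simp
qed

lemma detf_expand_single:
  assumes "r < Suc n" "c < Suc n" and "\<And>j. j < Suc n \<Longrightarrow> j \<noteq> c \<Longrightarrow> G r j = 0"
  shows "detf (Suc n) G = (-1) ^ (r + c) * G r c *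
    detf n (\<lambda>i j. G (if i < r then i else Suc i) (if j < c then j else Suc j))"
proof -
  let ?M = "mat (Suc n) (Suc n) (\<lambda>(i, j). G i j)"
  have "det ?M = (\<Sum>j<Suc n. ?M $$ (r, j) * cofactor ?M r j)"
    using assms(1) by (intro laplace_expansion_row) auto
  also have "\<dots> = (\<Sum>j<Suc n. if j = c then G r c * cofactor ?M r c else 0)"
    using assms by (intro sum.cong) auto
  also have "\<dots> = G r c * cofactor ?M r c"
    using assms(2) by simp
  also have "mat_delete ?M r c = mat n n
      (\<lambda>(i, j). G (if i < r then i else Suc i) (if j < c then j else Suc j))"
    using assms(1,2) by (intro eq_matI) (auto simp: mat_delete_def)
  then have "cofactor ?M r c = (-1) ^ (r + c) *
      detf n (\<lambda>i j. G (if i < r then i else Suc i) (if j < c then j else Suc j))"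
    by (simp only: cofactor_def)
  finally show ?thesis
    by simp
qed

text \<open>\<open>b * (b - 1) div 2\<close> counts the inversions in the reversal of
  \<open>b\<close> indices, hence gives the sign of an antitriangular block; this is its recursion
  when one row is peeled off.\<close>

lemma Suc_choose_2: "Suc b * (Suc b - 1) div 2 = b + b * (b - 1) div 2"
proof (cases b)
  case (Suc c)
  have "Suc b * (Suc b - 1) = b * 2 + b * (b - 1)"
    by (simp add: Suc algebra_simps)
  then show ?thesis by simp
qed simp

text \<open>Row \<open>c\<close> has its only entry in the last column. Expanding along it leaves
  the same pattern with one row less, down to the top left \<open>c\<close> by \<open>c\<close>
  block.\<close>

lemma detf_corner_right:
  assumes "\<And>i j. i < b \<Longrightarrow> i + j < c + b - 1 \<Longrightarrow> G (c + i) j = 0"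
    and "\<And>i j. i < b \<Longrightarrow> i + j = c + b - 1 \<Longrightarrow> G (c + i) j = e"
  shows "detf (c + b) G = (-1) ^ (b * (b - 1) div 2) * e ^ b * detf c G"
  using assms
proof (induction b arbitrary: G)
  case 0
  then show ?case by simp
next
  case (Suc b)
  let ?G = "\<lambda>i j. G (if i < c then i else Suc i) (if j < c + b then j else Suc j)"
  have e: "G c (c + b) = e"
    using Suc.prems(2)[of 0 "c + b"] by simp
  have z: "G c j = 0" if "j < Suc (c + b)" "j \<noteq> c + b" for j
    using Suc.prems(1)[of 0 j] that by simp
  have "detf (Suc (c + b)) G = (-1) ^ (c + (c + b)) * e * detf (c + b) ?G"
    unfolding e[symmetric] by (rule detf_expand_single) (use z in auto)
  also have "detf (c + b) ?G = detf (c + b) (\<lambda>i j. G (if i < c then i else Suc i) j)"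
    by (rule detf_cong) simp
  also have "\<dots> = (-1) ^ (b * (b - 1) div 2) * e ^ b *
      detf c (\<lambda>i j. G (if i < c then i else Suc i) j)"
  proof (rule Suc.IH)
    fix i j
    assume i: "i < b"
    show "G (if c + i < c then c + i else Suc (c + i)) j = 0" if "i + j < c + b - 1"
      using Suc.prems(1)[of "Suc i" j] i that by simp
    show "G (if c + i < c then c + i else Suc (c + i)) j = e" if "i + j = c + b - 1"
      using Suc.prems(2)[of "Suc i" j] i that by simp
  qed
  also have "detf c (\<lambda>i j. G (if i < c then i else Suc i) j) = detf c G"
    by (rule detf_cong) simp
  also have "(-1 :: int) ^ (c + (c + b)) = (-1) ^ b"
    by (simp add: minus_one_power_iff)
  finally show ?case
    unfolding Suc_choose_2 by (simp add: power_add mult_ac)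
qed

text \<open>Here the last row has its only entry in column 0. Each expansion drops the first column,
  hence the offset \<open>j + a\<close> in the block that is left.\<close>

lemma detf_corner_left:
  assumes "\<And>i j. i < a \<Longrightarrow> j < c + a \<Longrightarrow> a \<le> i + j \<Longrightarrow> G (c + i) j = 0"
    and "\<And>i j. i < a \<Longrightarrow> i + j = a - 1 \<Longrightarrow> G (c + i) j = d"
  shows "detf (c + a) G = (-1) ^ (c * a + a * (a - 1) div 2) * d ^ a * detf c (\<lambda>i j. G i (j + a))"
  using assms
proof (induction a arbitrary: G)
  case 0
  then show ?case by simp
next
  case (Suc a)
  let ?G = "\<lambda>i j. G (if i < c + a then i else Suc i) (if j < 0 then j else Suc j)"
  have d: "G (c + a) 0 = d"
    using Suc.prems(2)[of a 0] by simp
  have z: "G (c + a) j = 0" if "j < Suc (c + a)" "j \<noteq> 0" for j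
    using Suc.prems(1)[of a j] that by simp
  have "detf (Suc (c + a)) G = (-1) ^ (c + a + 0) * d * detf (c + a) ?G"
    unfolding d[symmetric] by (rule detf_expand_single) (use z in auto)
  also have "detf (c + a) ?G = detf (c + a) (\<lambda>i j. G i (Suc j))"
    by (rule detf_cong) simp
  also have "\<dots> = (-1) ^ (c * a + a * (a - 1) div 2) * d ^ a * detf c (\<lambda>i j. G i (Suc (j + a)))"
  proof (rule Suc.IH)
    fix i j
    assume i: "i < a"
    show "G (c + i) (Suc j) = 0" if "j < c + a" "a \<le> i + j"
      using Suc.prems(1)[of i "Suc j"] i that by simp
    show "G (c + i) (Suc j) = d" if "i + j = a - 1"
      using Suc.prems(2)[of i "Suc j"] i that by simp
  qed
  finally show ?case
    unfolding Suc_choose_2 by (simp add: power_add mult_ac)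
qed

section \<open>Hankel matrices and differences of rows at distance \<open>p\<close>\<close>

abbreviation hankel :: "(nat \<Rightarrow> int) \<Rightarrow> nat \<Rightarrow> nat \<Rightarrow> int" where
  "hankel x m n \<equiv> detf n (\<lambda>i j. x (m + i + j))"

text \<open>All subtractions are done at once by a lower triangular left factor;
  \<open>p > 0\<close> makes its diagonal 1.\<close>

lemma hankel_row_difference:
  "hankel x m n =
    detf n (\<lambda>i j. if i < p then x (m + i + j) else x (m + i + j) - x (m + (i - p) + j))"
  if "p > 0"
proof -
  let ?L = "\<lambda>i l. (if l = i then 1 else 0) - (if p \<le> i \<and> l = i - p then 1 else 0) :: int"
  have "detf n ?L = (\<Prod>i<n. ?L i i)"
    by (rule detf_lower_triangular) auto
  also have "\<dots> = 1"
    using that by (intro prod.neutral) auto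
  finally have L: "detf n ?L = 1" .
  have "hankel x m n = detf n ?L * hankel x m n"
    by (simp add: L)
  also have "\<dots> = detf n (\<lambda>i j. \<Sum>l<n. ?L i l * x (m + l + j))"
    by (rule detf_mult[symmetric])
  also have "\<dots> = detf n (\<lambda>i j. if i < p then x (m + i + j) else x (m + i + j) - x (m + (i - p) + j))"
  proof (rule detf_cong)
    fix i j
    assume i: "i < n"
    have "(\<Sum>l<n. ?L i l * x (m + l + j)) = (\<Sum>l<n. if l = i then x (m + i + j) else 0) -
        (\<Sum>l<n. if l = i - p then if p \<le> i then x (m + (i - p) + j) else 0 else 0)"
      unfolding sum_subtractf[symmetric] by (intro sum.cong) auto
    also have "\<dots> = x (m + i + j) - (if p \<le> i then x (m + (i - p) + j) else 0)"
      using i by (subst (1 2) sum.delta) auto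
    finally show "(\<Sum>l<n. ?L i l * x (m + l + j)) =
        (if i < p then x (m + i + j) else x (m + i + j) - x (m + (i - p) + j))"
      by simp
  qed
  finally show ?thesis .
qed

lemma hankel_eq_0:
  assumes "\<And>j. L \<le> j \<Longrightarrow> j \<le> R \<Longrightarrow> x (j + p) = x j"
    and "0 < p" "p < n" "L + p < m + n" "m + n \<le> Suc R" "L + n \<le> Suc R"
  shows "hankel x m n = 0"
proof -
  \<comment> \<open>The first difference row that starts inside the run; if \<open>m\<close> is
    already there, truncated subtraction gives row \<open>p\<close>.\<close>
  define i where "i = p + (L - m)"
  have "x (m + i + j) - x (m + (i - p) + j) = 0" if "j < n" for j
    using assms(1)[of "m + (L - m) + j"] assms(2-) that by (simp add: i_def ac_simps)
  moreover have "i < n"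
    using assms(2-) by (simp add: i_def)
  moreover have "\<not> i < p"
    by (simp add: i_def)
  ultimately have "detf n (\<lambda>i j. if i < p then x (m + i + j) else x (m + i + j) - x (m + (i - p) + j)) = 0"
    by (intro detf_zero_row[of i]) auto
  then show ?thesis
    by (simp add: hankel_row_difference[OF \<open>0 < p\<close>])
qed

text \<open>\<open>d\<close> and \<open>e\<close> are the defects of periodicity just before and
  just after the run. In the matrix of row differences, the \<open>a\<close> rows after the first
  \<open>p\<close> carry \<open>d\<close> on an antidiagonal in the left corner, the last
  \<open>b\<close> rows carry \<open>e\<close> in the right corner. Peeling off both leaves columns
  \<open>a\<close> to \<open>a + p - 1\<close> of the first \<open>p\<close> rows. The guards
  \<open>a > 0\<close> and \<open>b > 0\<close> admit empty corners.\<close>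

lemma hankel_frame:
  assumes per: "\<And>j. L \<le> j \<Longrightarrow> j \<le> R \<Longrightarrow> x (j + p) = x j"
    and d: "a > 0 \<Longrightarrow> x (m + a - 1 + p) - x (m + a - 1) = d"
    and e: "b > 0 \<Longrightarrow> x (Suc R + p) - x (Suc R) = e"
    and p: "0 < p" and L: "L \<le> m + a" and R: "a > 0 \<Longrightarrow> m + a + (p + a + b) \<le> R + 2"
    and b: "b > 0 \<Longrightarrow> m + a + (p + a + b) = R + 2"
  shows "hankel x m (p + a + b) =
    (-1) ^ (b * (b - 1) div 2 + p * a + a * (a - 1) div 2) * d ^ a * e ^ b * hankel x (m + a) p"
proof -
  define G where
    "G i j = (if i < p then x (m + i + j) else x (m + i + j) - x (m + (i - p) + j))" for i j
  have diff: "x (m + (p + i) + j) - x (m + i + j) = 0"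
    if "L \<le> m + i + j" "m + i + j \<le> R" for i j
    using per[OF that] by (simp add: ac_simps)
  have "hankel x m (p + a + b) = detf (p + a + b) G"
    unfolding G_def by (rule hankel_row_difference[OF p])
  also have "\<dots> = (-1) ^ (b * (b - 1) div 2) * e ^ b * detf (p + a) G"
  proof (rule detf_corner_right)
    fix i j
    assume i: "i < b"
    then have eq: "m + a + (p + a + b) = R + 2"
      using b by simp
    show "G (p + a + i) j = 0" if "i + j < p + a + b - 1"
      using diff[of "a + i" j] that eq L by (simp add: G_def ac_simps)
    show "G (p + a + i) j = e" if "i + j = p + a + b - 1"
    proof -
      have "m + a + i + j = Suc R"
        using that eq p by simp
      then have "x (m + a + i + j + p) - x (m + a + i + j) = e"
        using e i by simp
      then show ?thesis
        by (simp add: G_def ac_simps)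
    qed
  qed
  also have "detf (p + a) G = (-1) ^ (p * a + a * (a - 1) div 2) * d ^ a *
      detf p (\<lambda>i j. G i (j + a))"
  proof (rule detf_corner_left)
    fix i j
    assume i: "i < a"
    show "G (p + i) j = 0" if "j < p + a" "a \<le> i + j"
      using diff[of i j] that R L i by (simp add: G_def ac_simps)
    show "G (p + i) j = d" if "i + j = a - 1"
    proof -
      have "m + i + j = m + a - 1"
        using that i by simp
      then have "x (m + i + j + p) - x (m + i + j) = d"
        using d i by simp
      then show ?thesis
        by (simp add: G_def ac_simps)
    qed
  qed
  also have "detf p (\<lambda>i j. G i (j + a)) = hankel x (m + a) p"
    by (rule detf_cong) (simp add: G_def ac_simps)
  finally show ?thesis
    by (simp add: power_add mult_ac)
qed

subsection \<open>Circulant Hankel determinants\<close>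

lemma mod_eq_0_iff_less_double:
  fixes a p :: nat
  assumes "a < 2 * p"
  shows "a mod p = 0 \<longleftrightarrow> a = 0 \<or> a = p"
proof (cases "a < p")
  case False
  then have "a mod p = a - p"
    using assms by (simp add: le_mod_geq)
  then show ?thesis
    using False by auto
qed auto

section \<open>Permutations of rows and columns\<close>

lemma detf_permute_rows:
  assumes "\<pi> permutes {0..<n}"
  shows "detf n (\<lambda>i j. G (\<pi> i) j) = sign \<pi> * detf n G"
proof -
  have "\<pi> i < n" if "i < n" for i
    using permutes_in_image[OF assms, of i] that by simp
  then have "mat n n (\<lambda>(i, j). G (\<pi> i) j) =
      mat n n (\<lambda>(i, j). mat n n (\<lambda>(i, j). G i j) $$ (\<pi> i, j))"
    by (intro eq_matI) auto
  moreover have "det (mat n n (\<lambda>(i, j). mat n n (\<lambda>(i, j). G i j) $$ (\<pi> i, j))) =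
      of_int (sign \<pi>) * detf n G"
    by (rule det_permute_rows[OF mat_carrier assms])
  ultimately show ?thesis
    by (simp only: of_int_eq_id id_apply)
qed

lemma detf_transpose: "detf n (\<lambda>i j. G j i) = detf n G"
proof -
  have "mat n n (\<lambda>(i, j). G j i) = transpose_mat (mat n n (\<lambda>(i, j). G i j))"
    by (rule eq_matI) auto
  then show ?thesis
    by (metis det_transpose mat_carrier)
qed

lemma detf_permute_cols:
  assumes "\<pi> permutes {0..<n}"
  shows "detf n (\<lambda>i j. G i (\<pi> j)) = sign \<pi> * detf n G"
  using detf_permute_rows[OF assms, of "\<lambda>i j. G j i"]
    detf_transpose[of n G] detf_transpose[of n "\<lambda>i j. G i (\<pi> j)"] by simp

lemma mult_mod_permutes:
  fixes h p :: nat
  assumes "coprime h p"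
  shows "(\<lambda>i. if i < p then (h * i) mod p else i) permutes {0..<p}"
proof (rule bij_imp_permutes)
  have "inj_on (\<lambda>i. if i < p then (h * i) mod p else i) {0..<p}"
  proof (rule inj_onI)
    fix i j
    assume "i \<in> {0..<p}" "j \<in> {0..<p}"
      and "(if i < p then (h * i) mod p else i) = (if j < p then (h * j) mod p else j)"
    then have "[h * i = h * j] (mod p)" "i < p" "j < p"
      by (auto simp: cong_def)
    then show "i = j"
      using cong_mult_lcancel_nat[OF assms] by (simp add: cong_def)
  qed
  moreover have "(\<lambda>i. if i < p then (h * i) mod p else i) ` {0..<p} = {0..<p}"
    by (rule endo_inj_surj[OF _ _ calculation]) auto
  ultimately show "bij_betw (\<lambda>i. if i < p then (h * i) mod p else i) {0..<p} {0..<p}"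
    by (rule bij_betw_imageI)
qed auto

lemma add_mod_permutes:
  fixes p :: nat
  shows "(\<lambda>i. if i < p then (i + c) mod p else i) permutes {0..<p}"
proof (rule bij_imp_permutes)
  have "inj_on (\<lambda>i. if i < p then (i + c) mod p else i) {0..<p}"
  proof (rule inj_onI)
    fix i j
    assume "i \<in> {0..<p}" "j \<in> {0..<p}"
      and "(if i < p then (i + c) mod p else i) = (if j < p then (j + c) mod p else j)"
    then have "[i + c = j + c] (mod p)" "i < p" "j < p"
      by (auto simp: cong_def)
    then show "i = j"
      using cong_add_rcancel_nat[of i c j p] by (simp add: cong_def)
  qed
  moreover have "(\<lambda>i. if i < p then (i + c) mod p else i) ` {0..<p} = {0..<p}"
    by (rule endo_inj_surj[OF _ _ calculation]) auto
  ultimately show "bij_betw (\<lambda>i. if i < p then (i + c) mod p else i) {0..<p} {0..<p}"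
    by (rule bij_betw_imageI)
qed auto

text \<open>The circulant matrix \<open>e (P ^ h - 1) + r J\<close>, with \<open>P\<close> the
  cyclic shift of \<open>p\<close> indices and \<open>J\<close> the all-ones matrix.\<close>

definition shift_mat :: "nat \<Rightarrow> int \<Rightarrow> int \<Rightarrow> nat \<Rightarrow> nat \<Rightarrow> nat \<Rightarrow> int" where
  "shift_mat p e r h i j = e * (of_bool (j = (i + h) mod p) - of_bool (j = i)) + r"

text \<open>Relabelling the indices by multiplication with \<open>h\<close> turns the shift by 1
  into the shift by \<open>h\<close>. Rows and columns are permuted alike, so the sign occurs
  squared.\<close>

lemma det_shift_mat_coprime:
  assumes "coprime h p"
  shows "detf p (shift_mat p e r h) = detf p (shift_mat p e r 1)"
proof -
  define \<pi> where "\<pi> i = (if i < p then (h * i) mod p else i)" for i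
  have \<pi>: "\<pi> permutes {0..<p}"
    unfolding \<pi>_def by (rule mult_mod_permutes[OF assms])
  have "detf p (shift_mat p e r 1) = detf p (\<lambda>i j. shift_mat p e r h (\<pi> i) (\<pi> j))"
  proof (rule detf_cong)
    fix i j
    assume ij: "i < p" "j < p"
    have "\<pi> j = (\<pi> i + h) mod p \<longleftrightarrow> [h * j = h * (i + 1)] (mod p)"
      using ij by (auto simp: \<pi>_def cong_def mod_simps add.commute)
    also have "\<dots> \<longleftrightarrow> [j = i + 1] (mod p)"
      by (rule cong_mult_lcancel_nat[OF assms])
    also have "\<dots> \<longleftrightarrow> j = (i + 1) mod p"
      using ij by (simp add: cong_def)
    finally have "\<pi> j = (\<pi> i + h) mod p \<longleftrightarrow> j = (i + 1) mod p" .
    moreover have "\<pi> j = \<pi> i \<longleftrightarrow> j = i"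
      by (rule inj_eq[OF permutes_inj[OF \<pi>]])
    ultimately show "shift_mat p e r 1 i j = shift_mat p e r h (\<pi> i) (\<pi> j)"
      by (simp add: shift_mat_def)
  qed
  also have "\<dots> = sign \<pi> * detf p (\<lambda>i j. shift_mat p e r h i (\<pi> j))"
    by (rule detf_permute_rows[OF \<pi>])
  also have "\<dots> = sign \<pi> * (sign \<pi> * detf p (shift_mat p e r h))"
    unfolding detf_permute_cols[OF \<pi>] ..
  finally show ?thesis
    by (simp add: sign_def)
qed

lemma sum_shift_mat_mult:
  assumes "i < p"
  shows "(\<Sum>l<p. shift_mat p e r h i l * v l) = e * (v ((i + h) mod p) - v i) + r * (\<Sum>l<p. v l)"
proof -
  have "(\<Sum>l<p. shift_mat p e r h i l * v l) =
      (\<Sum>l<p. (if l = (i + h) mod p then e * v ((i + h) mod p) else 0) -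
        (if l = i then e * v i else 0) + r * v l)"
    by (intro sum.cong) (auto simp: shift_mat_def algebra_simps)
  also have "\<dots> = e * v ((i + h) mod p) - e * v i + r * (\<Sum>l<p. v l)"
    using assms by (simp add: sum.distrib sum_subtractf sum_distrib_left)
  finally show ?thesis
    by (simp add: algebra_simps)
qed

text \<open>Isolates the dependence on \<open>e\<close> and \<open>r\<close>: once all columns are
  added to column 0, that column is constantly \<open>p r\<close>, and the matrix has a left factor
  \<open>W\<close> that involves neither \<open>e\<close> nor \<open>r\<close>.\<close>

lemma det_shift_mat_factor:
  assumes "p > 0"
  shows "\<exists>w. \<forall>e r. detf p (shift_mat p e r 1) = w * (int p * r * e ^ (p - 1))"
proof -
  define W :: "nat \<Rightarrow> nat \<Rightarrow> int" where "W i j = (if j = 0 then 1 else shift_mat p 1 0 1 i j)" for i j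
  have "detf p (shift_mat p e r 1) = detf p W * (int p * r * e ^ (p - 1))" for e r
  proof -
    \<comment> \<open>\<open>C\<close> performs the column additions, and \<open>T\<close> is the
      triangular factor that carries \<open>e\<close> and \<open>r\<close>; the identity used is
      \<open>shift_mat * C = W * T\<close>.\<close>
    define C :: "nat \<Rightarrow> nat \<Rightarrow> int" where "C l j = (if l = j \<or> j = 0 then 1 else 0)" for l j
    define T :: "nat \<Rightarrow> nat \<Rightarrow> int" where
      "T l j = (if l = 0 then if j = 0 then int p * r else r else if l = j then e else 0)" for l j
    have "detf p C = (\<Prod>i<p. C i i)"
      by (rule detf_lower_triangular) (simp add: C_def)
    then have C: "detf p C = 1"
      by (simp add: C_def)
    have "detf p T = (\<Prod>i<p. T i i)"
      by (rule detf_upper_triangular) (simp add: T_def)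
    also have "\<dots> = T 0 0 * (\<Prod>i\<in>{..<p} - {0}. T i i)"
      using assms by (intro prod.remove) auto
    also have "(\<Prod>i\<in>{..<p} - {0}. T i i) = e ^ (p - 1)"
      using assms by (simp add: T_def)
    finally have T: "detf p T = int p * r * e ^ (p - 1)"
      by (simp add: T_def)
    have "detf p (shift_mat p e r 1) * detf p C = detf p (\<lambda>i j. \<Sum>l<p. shift_mat p e r 1 i l * C l j)"
      by (rule detf_mult[symmetric])
    also have "\<dots> = detf p (\<lambda>i j. \<Sum>l<p. W i l * T l j)"
    proof (rule detf_cong)
      fix i j
      assume ij: "i < p" "j < p"
      have L: "(\<Sum>l<p. shift_mat p e r 1 i l * C l j) =
          (if j = 0 then int p * r else shift_mat p e r 1 i j)"
      proof (cases "j = 0")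
        case True
        then show ?thesis
          using sum_shift_mat_mult[OF ij(1), of e r 1 "\<lambda>l. C l j"] by (simp add: C_def)
      next
        case False
        then have "(\<Sum>l<p. shift_mat p e r 1 i l * C l j) =
            (\<Sum>l<p. if l = j then shift_mat p e r 1 i j else 0)"
          by (intro sum.cong) (auto simp: C_def)
        then show ?thesis
          using False ij by simp
      qed
      have "(\<Sum>l<p. W i l * T l j) = W i 0 * T 0 j + (\<Sum>l\<in>{..<p} - {0}. W i l * T l j)"
        using assms by (intro sum.remove) auto
      also have "(\<Sum>l\<in>{..<p} - {0}. W i l * T l j) =
          (\<Sum>l\<in>{..<p} - {0}. if l = j then W i j * e else 0)"
        by (intro sum.cong) (auto simp: T_def)
      also have "\<dots> = (if j = 0 then 0 else W i j * e)"
        using ij by simp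
      finally have "(\<Sum>l<p. W i l * T l j) = (if j = 0 then int p * r else shift_mat p e r 1 i j)"
        by (simp add: W_def T_def shift_mat_def)
      with L show "(\<Sum>l<p. shift_mat p e r 1 i l * C l j) = (\<Sum>l<p. W i l * T l j)"
        by simp
    qed
    also have "\<dots> = detf p W * detf p T"
      by (rule detf_mult)
    finally show ?thesis
      by (simp add: C T)
  qed
  then show ?thesis
    by blast
qed

text \<open>A kernel vector drops by its sum \<open>S\<close> at each cyclic step. Going round once
  forces \<open>p S = 0\<close>, so the vector is constant with sum 0 and vanishes.\<close>

lemma det_shift_mat_nonzero:
  assumes "p > 0"
  shows "detf p (shift_mat p 1 1 1) \<noteq> 0"
proof
  assume "detf p (shift_mat p 1 1 1) = 0"
  then have "\<exists>v. v \<in> carrier_vec p \<and> v \<noteq> 0\<^sub>v p \<and>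
      mat p p (\<lambda>(i, j). shift_mat p 1 1 1 i j) *\<^sub>v v = 0\<^sub>v p"
    by (rule det_0_iff_vec_prod_zero[OF mat_carrier, THEN iffD1])
  then obtain v where v: "v \<in> carrier_vec p" "v \<noteq> 0\<^sub>v p"
    and 0: "mat p p (\<lambda>(i, j). shift_mat p 1 1 1 i j) *\<^sub>v v = 0\<^sub>v p"
    by blast
  define S where "S = (\<Sum>l<p. v $ l)"
  have step: "v $ ((i + 1) mod p) = v $ i - S" if "i < p" for i
  proof -
    have "0 = (mat p p (\<lambda>(i, j). shift_mat p 1 1 1 i j) *\<^sub>v v) $ i"
      using that 0 by simp
    also have "\<dots> = (\<Sum>l<p. shift_mat p 1 1 1 i l * v $ l)"
      using that v by (simp add: scalar_prod_def atLeast0LessThan)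
    also have "\<dots> = v $ ((i + 1) mod p) - v $ i + S"
      unfolding S_def sum_shift_mat_mult[OF that] by simp
    finally show ?thesis
      by simp
  qed
  have lin: "v $ i = v $ 0 - int i * S" if "i < p" for i
    using that
  proof (induction i)
    case (Suc i)
    then show ?case
      using step[of i] by (simp add: algebra_simps)
  qed simp
  have "v $ 0 = v $ (p - 1) - S"
    using step[of "p - 1"] assms by simp
  then have "int p * S = 0"
    using lin[of "p - 1"] assms by (simp add: of_nat_diff algebra_simps)
  then have S: "S = 0"
    using assms by simp
  have const: "v $ i = v $ 0" if "i < p" for i
    using lin[OF that] S by simp
  have "S = (\<Sum>l<p. v $ 0)"
    unfolding S_def by (rule sum.cong[OF refl], rule const) simp
  then have "v $ 0 = 0"
    using S assms by simp
  then have "v $ i = 0" if "i < p" for i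
    using const[OF that] by simp
  then have "v = 0\<^sub>v p"
    using v(1) by (intro eq_vecI) auto
  with v(2) show False ..
qed

section \<open>Hankel matrices of sequences with an odd period\<close>

context
  fixes x :: "nat \<Rightarrow> int" and p :: nat
  assumes per: "\<And>i. x (i + p) = x i" and odd: "odd p"
begin

lemma periodic_mod: "x (i mod p) = x i"
proof -
  have "x (j + n * p) = x j" for j n
  proof (induction n)
    case (Suc n)
    have "x (j + Suc n * p) = x (j + n * p + p)"
      by (simp add: ac_simps)
    then show ?case
      using Suc per by simp
  qed simp
  from this[of "i mod p" "i div p"] show ?thesis
    by simp
qed

lemma periodic_cong: "i mod p = j mod p \<Longrightarrow> x i = x j"
  by (metis periodic_mod)

lemma sum_period: "(\<Sum>i<p. x (c + i)) = (\<Sum>i<p. x i)"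
proof (induction c)
  case (Suc c)
  have "(\<Sum>i<p. x (Suc c + i)) + x c = (\<Sum>i<Suc p. x (c + i))"
    by (subst sum.lessThan_Suc_shift) simp
  also have "\<dots> = (\<Sum>i<p. x (c + i)) + x c"
    by (simp add: per)
  finally show ?case
    using Suc by simp
qed simp

text \<open>Shifting the start by one permutes the columns cyclically. Since \<open>p\<close> shifts
  restore the matrix and \<open>p\<close> is odd, the sign of this permutation is 1 or the
  determinant is 0.\<close>

lemma hankel_period: "hankel x c p = hankel x 0 p"
proof -
  define \<rho> where "\<rho> i = (if i < p then (i + 1) mod p else i)" for i
  have \<rho>: "\<rho> permutes {0..<p}"
    unfolding \<rho>_def by (rule add_mod_permutes)
  have step: "hankel x (Suc c) p = sign \<rho> * hankel x c p" for c
  proof -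
    have "hankel x (Suc c) p = detf p (\<lambda>i j. x (c + i + \<rho> j))"
      by (rule detf_cong) (auto simp: \<rho>_def mod_simps intro!: periodic_cong)
    also have "\<dots> = sign \<rho> * hankel x c p"
      by (rule detf_permute_cols[OF \<rho>])
    finally show ?thesis .
  qed
  have pow: "hankel x c p = sign \<rho> ^ c * hankel x 0 p" for c
  proof (induction c)
    case (Suc c)
    show ?case
      unfolding step Suc.IH by simp
  qed simp
  have "hankel x p p = hankel x 0 p"
    by (rule detf_cong, rule periodic_cong) (simp add: add.assoc)
  then have "sign \<rho> ^ p * hankel x 0 p = hankel x 0 p"
    using pow[of p] by simp
  then show ?thesis
    unfolding pow[of c] using odd by (auto simp: sign_def)
qed

text \<open>Writing \<open>P\<close> for the cyclic shift, \<open>J\<close> for the all-ones matrix, \<open>R\<close> for the reversal and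
  \<open>r\<close> for the sum over a period, the hypothesis on \<open>x\<close> says
  \<open>(P ^ h - 1 + J) M = R (e (P - 1) + r J)\<close> for a suitable rotation \<open>M\<close> of the Hankel matrix.
  As \<open>P ^ h\<close> is a permutation conjugate of \<open>P\<close>, the determinants of \<open>P ^ h - 1 + J\<close> and of
  \<open>e (P - 1) + r J\<close> only differ by the factor \<open>r\<close>.\<close>

lemma hankel_circulant:
  assumes h: "coprime h p" and e: "e = 1 \<or> e = -1"
    and diff: "\<And>i. x (i + h) - x i =
      e * (of_bool (i mod p = (g + 1) mod p) - of_bool (i mod p = g mod p))"
  shows "hankel x c p = (-1) ^ ((p - 1) div 2) * (\<Sum>i<p. x i)"
proof -
  define r where "r = (\<Sum>i<p. x i)"
  define R :: "nat \<Rightarrow> nat \<Rightarrow> int" where "R i l = of_bool (i + l = p - 1)" for i l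
  have p: "p > 0"
    using odd by (rule odd_pos)
  have "detf (0 + p) R = (-1) ^ (p * (p - 1) div 2) * 1 ^ p * detf 0 R"
    by (rule detf_corner_right) (simp_all add: R_def)
  also have "p * (p - 1) div 2 = p * ((p - 1) div 2)"
    using odd by (auto elim!: oddE)
  finally have R: "detf p R = (-1) ^ ((p - 1) div 2)"
    using odd by (simp add: power_mult)
  \<comment> \<open>Starting at \<open>g + 1\<close> puts the two exceptional residues at
    \<open>i + j = 0\<close> and \<open>i + j = -1\<close> modulo \<open>p\<close>: the pattern of a
    shift matrix with its rows reversed.\<close>
  have "detf p (shift_mat p 1 1 h) * hankel x (g + 1) p =
      detf p (\<lambda>i j. \<Sum>l<p. shift_mat p 1 1 h i l * x (g + 1 + l + j))"
    by (rule detf_mult[symmetric])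
  also have "\<dots> = detf p (\<lambda>i j. \<Sum>l<p. R i l * shift_mat p e r 1 l j)"
  proof (rule detf_cong)
    fix i j
    assume ij: "i < p" "j < p"
    have "(\<Sum>l<p. shift_mat p 1 1 h i l * x (g + 1 + l + j)) =
        x (g + 1 + (i + h) mod p + j) - x (g + 1 + i + j) + (\<Sum>l<p. x (g + 1 + j + l))"
      unfolding sum_shift_mat_mult[OF ij(1)] by (simp add: ac_simps)
    also have "(\<Sum>l<p. x (g + 1 + j + l)) = r"
      unfolding r_def by (rule sum_period)
    also have "x (g + 1 + (i + h) mod p + j) = x (g + 1 + i + j + h)"
    proof (rule periodic_cong)
      have "(g + 1 + (i + h) mod p + j) mod p = ((i + h) mod p + (g + 1 + j)) mod p"
        by (simp only: ac_simps)
      also have "\<dots> = (i + h + (g + 1 + j)) mod p"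
        by (rule mod_add_left_eq)
      finally show "(g + 1 + (i + h) mod p + j) mod p = (g + 1 + i + j + h) mod p"
        by (simp only: ac_simps)
    qed
    also have "x (g + 1 + i + j + h) - x (g + 1 + i + j) =
        e * (of_bool ((g + 1 + i + j) mod p = (g + 1) mod p) -
          of_bool ((g + 1 + i + j) mod p = g mod p))"
      by (rule diff)
    also have "(g + 1 + i + j) mod p = (g + 1) mod p \<longleftrightarrow> [(g + 1) + (i + j) = (g + 1) + 0] (mod p)"
      by (simp add: cong_def ac_simps)
    also have "\<dots> \<longleftrightarrow> (i + j) mod p = 0"
      unfolding cong_add_lcancel_nat by (simp add: cong_def)
    also have "\<dots> \<longleftrightarrow> j = (p - 1 - i + 1) mod p"
      using ij mod_eq_0_iff_less_double[of "i + j" p] by (cases "i = 0") auto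
    also have "(g + 1 + i + j) mod p = g mod p \<longleftrightarrow> [g + (i + j + 1) = g + 0] (mod p)"
      by (simp add: cong_def ac_simps)
    also have "\<dots> \<longleftrightarrow> (i + j + 1) mod p = 0"
      unfolding cong_add_lcancel_nat by (simp add: cong_def)
    also have "\<dots> \<longleftrightarrow> j = p - 1 - i"
      using ij mod_eq_0_iff_less_double[of "i + j + 1" p] by auto
    finally have L: "(\<Sum>l<p. shift_mat p 1 1 h i l * x (g + 1 + l + j)) = shift_mat p e r 1 (p - 1 - i) j"
      by (simp add: shift_mat_def)
    have "(\<Sum>l<p. R i l * shift_mat p e r 1 l j) =
        (\<Sum>l<p. if l = p - 1 - i then shift_mat p e r 1 (p - 1 - i) j else 0)"
      using ij by (intro sum.cong) (auto simp: R_def)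
    then show "(\<Sum>l<p. shift_mat p 1 1 h i l * x (g + 1 + l + j)) =
        (\<Sum>l<p. R i l * shift_mat p e r 1 l j)"
      using L p by simp
  qed
  also have "\<dots> = detf p R * detf p (shift_mat p e r 1)"
    by (rule detf_mult)
  also have "detf p (shift_mat p e r 1) = r * detf p (shift_mat p 1 1 1)"
  proof -
    obtain w where w: "\<And>e r. detf p (shift_mat p e r 1) = w * (int p * r * e ^ (p - 1))"
      using det_shift_mat_factor[OF p] by blast
    have "e ^ (p - 1) = 1"
      using e odd by auto
    then show ?thesis
      unfolding w by simp
  qed
  finally have "detf p (shift_mat p 1 1 1) * hankel x (g + 1) p =
      detf p (shift_mat p 1 1 1) * ((-1) ^ ((p - 1) div 2) * r)"
    by (simp add: det_shift_mat_coprime[OF h] R)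
  then have "hankel x (g + 1) p = (-1) ^ ((p - 1) div 2) * r"
    by (rule mult_left_cancel[OF det_shift_mat_nonzero[OF p], THEN iffD1])
  then show ?thesis
    unfolding r_def hankel_period[of "g + 1"] hankel_period[of c] .
qed

end

subsection \<open>Factors of the fixed point\<close>

definition A :: "nat \<Rightarrow> nat list" where "A k = (tau ^^ k) [1]"
definition B :: "nat \<Rightarrow> nat list" where "B k = (tau ^^ k) [0]"

lemma A_0: "A 0 = [1]" and B_0: "B 0 = [0]"
  by (simp_all add: A_def B_def)

lemma A_Suc: "A (Suc k) = A k @ B k @ A k"
proof -
  have "A (Suc k) = A k @ (tau ^^ k) ([0] @ [1])"
    unfolding A_def tau_pow_Suc_1 by simp
  then show ?thesis
    unfolding tau_pow_append by (simp add: A_def B_def)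
qed

lemma B_Suc: "B (Suc k) = A k"
proof -
  have "B (Suc k) = (tau ^^ k) (tau [0])"
    unfolding B_def by (simp only: funpow_Suc_right o_apply)
  then show ?thesis
    by (simp add: A_def tau_def tau_letter_def)
qed

lemma length_A: "length (A k) = f (2 * k)"
  by (simp add: A_def f_def)

lemma length_A_B: "length (A k) + length (B k) = f (2 * k + 1)"
proof -
  have "length (A k @ B k) = f (2 * k + 1)"
    unfolding A_def B_def tau_pow_append[symmetric] by (simp add: f_def)
  then show ?thesis
    by simp
qed

lemma odd_length_A: "odd (length (A k))"
  using f_parity[of k] by (simp add: length_A)

text \<open>The pair of lengths \<open>(q, p)\<close> becomes \<open>(p, 2 p + q)\<close>, which
  preserves the gcd. Thus \<open>length (B k)\<close> qualifies as the shift \<open>h\<close> in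
  \<open>hankel_circulant\<close>.\<close>

lemma coprime_length_B_A: "coprime (length (B k)) (length (A k))"
proof (induction k)
  case (Suc k)
  have "gcd (length (A k)) (2 * length (A k) + length (B k)) = gcd (length (A k)) (length (B k))"
    using gcd_add_mult[of "length (A k)" 2 "length (B k)"] by simp
  then show ?case
    using Suc by (simp add: A_Suc B_Suc coprime_iff_gcd_eq_1 gcd.commute mult_2 add.commute add.left_commute)
qed (simp add: A_0 B_0)

text \<open>With \<open>length_A_B\<close>, the first half counts the ones of \<open>A k\<close> as
  \<open>f (2 * k + 1) / 2\<close>; the second half carries the induction.\<close>

lemma sum_list_A_B:
  "2 * sum_list (A k) = length (A k) + length (B k) \<and>
   2 * sum_list (B k) + length (B k) = length (A k)"
  by (induction k) (auto simp: A_0 B_0 A_Suc B_Suc)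

text \<open>The words \<open>A k @ B k\<close> and \<open>B k @ A k\<close> only differ by a swap of two adjacent letters; \<open>pre k\<close>
  and \<open>suf k\<close> are what precedes and follows these letters.\<close>

primrec pre :: "nat \<Rightarrow> nat list" where
  "pre 0 = []"
| "pre (Suc k) = A k @ pre k"

primrec suf :: "nat \<Rightarrow> nat list" where
  "suf 0 = []"
| "suf (Suc k) = suf k @ A k"

text \<open>With \<open>A = A k\<close> and \<open>B = B k\<close>, the products at the next level
  are \<open>A (B A) A\<close> and \<open>A (A B) A\<close>, so each level reverses the direction of
  the swap.\<close>

lemma A_B_almost_commute:
  "A k @ B k = pre k @ [of_bool (even k), of_bool (odd k)] @ suf k"
  "B k @ A k = pre k @ [of_bool (odd k), of_bool (even k)] @ suf k"
proof (induction k)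
  case (Suc k)
  have "A (Suc k) @ B (Suc k) = A k @ (B k @ A k) @ A k"
    "B (Suc k) @ A (Suc k) = A k @ (A k @ B k) @ A k"
    by (simp_all add: A_Suc B_Suc)
  with Suc show
    "A (Suc k) @ B (Suc k) = pre (Suc k) @ [of_bool (even (Suc k)), of_bool (odd (Suc k))] @ suf (Suc k)"
    "B (Suc k) @ A (Suc k) = pre (Suc k) @ [of_bool (odd (Suc k)), of_bool (even (Suc k))] @ suf (Suc k)"
    by (simp_all del: append_assoc)
qed (simp_all add: A_0 B_0)

text \<open>The swapped letters lie exactly in the middle of \<open>A k @ B k\<close>.\<close>

lemma length_pre: "length (A k) + length (B k) = 2 * length (pre k) + 2"
  by (induction k) (simp_all add: A_0 B_0 A_Suc B_Suc)

lemma even_length_pre: "even (length (pre k)) \<longleftrightarrow> even k"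
  by (induction k) (simp_all add: odd_length_A)

lemma nth_A_B_diff:
  assumes "i < length (A k) + length (B k)"
  shows "int ((B k @ A k) ! i) - int ((A k @ B k) ! i) =
    (-1) ^ k * (of_bool (i = length (pre k) + 1) - of_bool (i = length (pre k)))"
  unfolding A_B_almost_commute
  by (auto simp: nth_append nth_Cons' minus_one_power_iff)

text \<open>For \<open>k = Suc k'\<close>, rotating the cyclic word
  \<open>A k' @ B k' @ A k'\<close> by \<open>length (B k) = length (A k')\<close> gives
  \<open>B k' @ A k' @ A k'\<close>. This only swaps two adjacent letters, so
  \<open>hankel_circulant\<close> applies.\<close>

lemma hankel_A:
  "hankel (\<lambda>i. int (A k ! (i mod length (A k)))) c (length (A k)) =
    (-1) ^ ((length (A k) - 1) div 2) * int (sum_list (A k))"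
proof -
  define p where "p = length (A k)"
  define x where "x i = int (A k ! (i mod p))" for i
  have p: "p > 0"
    using odd_length_A[of k] by (auto simp: p_def intro: odd_pos)
  have "\<exists>e g. (e = 1 \<or> e = -1) \<and> (\<forall>i. x (i + length (B k)) - x i =
      e * (of_bool (i mod p = (g + 1) mod p) - of_bool (i mod p = g mod p)))"
  proof (cases k)
    \<comment> \<open>The word is a single letter; with period 1 both sides vanish for every
      \<open>g\<close>.\<close>
    case 0
    then show ?thesis
      by (simp add: x_def p_def A_0) (use zero_neq_one in blast)
  next
    case (Suc k')
    define a b g where "a = length (A k')" and "b = length (B k')" and "g = length (pre k')"
    have g: "a + b = 2 * g + 2"
      unfolding a_def b_def g_def by (rule length_pre)
    have a: "a > 0"
      using odd_length_A[of k'] by (auto simp: a_def intro: odd_pos)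
    have pab: "p = a + b + a"
      by (simp add: p_def Suc A_Suc a_def b_def)
    have "x (i + length (B k)) - x i =
      (-1) ^ k' * (of_bool (i mod p = (g + 1) mod p) - of_bool (i mod p = g mod p))" for i
    proof -
      define t where "t = i mod p"
      have t: "t < p"
        using p by (simp add: t_def)
      have B: "length (B k) = a"
        by (simp add: Suc B_Suc a_def)
      have xi: "x i = int (A k ! t)"
        by (simp add: x_def t_def)
      have xb: "x (i + length (B k)) = int (A k ! ((t + a) mod p))"
        unfolding x_def B t_def by (simp add: mod_simps)
      have gp: "(g + 1) mod p = g + 1" "g mod p = g"
        using g a by (simp_all add: pab)
      show ?thesis
      proof (cases "t < a + b")
        case True
        have "A k ! ((t + a) mod p) = (A k' @ (B k' @ A k')) ! (t + a)"
          using True by (simp add: Suc A_Suc pab)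
        also have "\<dots> = (B k' @ A k') ! t"
          by (simp add: nth_append a_def)
        finally have "x (i + length (B k)) = int ((B k' @ A k') ! t)"
          using xb by simp
        moreover have "A k ! t = ((A k' @ B k') @ A k') ! t"
          by (simp add: Suc A_Suc)
        then have "A k ! t = (A k' @ B k') ! t"
          using True by (subst (asm) nth_append) (simp add: a_def b_def)
        ultimately show ?thesis
          unfolding gp t_def[symmetric]
          using nth_A_B_diff[of t k'] True xi by (simp add: a_def b_def g_def)
      next
        \<comment> \<open>The rotation takes the last copy of \<open>A k'\<close> to the first
          one.\<close>
        case False
        have idx: "t - (a + b) < a"
          using False t a unfolding pab by linarith
        have "(t + a) mod p = t - (a + b)"
          using False t by (simp add: pab le_mod_geq)
        then have "A k ! ((t + a) mod p) = (A k' @ (B k' @ A k')) ! (t - (a + b))"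
          by (simp add: Suc A_Suc)
        also have "\<dots> = A k' ! (t - (a + b))"
          using idx by (simp add: nth_append a_def)
        also have "\<dots> = ((A k' @ B k') @ A k') ! t"
          using False by (subst nth_append) (simp add: a_def b_def)
        also have "\<dots> = A k ! t"
          by (simp add: Suc A_Suc)
        finally show ?thesis
          unfolding xi xb gp using False g by (simp add: t_def)
      qed
    qed
    moreover have "(-1 :: int) ^ k' = 1 \<or> (-1 :: int) ^ k' = -1"
      by (cases "even k'") simp_all
    ultimately show ?thesis
      by blast
  qed
  then obtain e g where eg: "e = 1 \<or> e = -1"
    "\<And>i. x (i + length (B k)) - x i =
      e * (of_bool (i mod p = (g + 1) mod p) - of_bool (i mod p = g mod p))"
    by blast
  have "hankel x c p = (-1) ^ ((p - 1) div 2) * (\<Sum>i<p. x i)"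
  proof (rule hankel_circulant[OF _ _ _ eg])
    show "odd p"
      unfolding p_def by (rule odd_length_A)
    show "coprime (length (B k)) p"
      unfolding p_def by (rule coprime_length_B_A)
  qed (simp add: x_def)
  also have "(\<Sum>i<p. x i) = int (sum_list (A k))"
    by (simp add: x_def sum_list_sum_nth p_def atLeast0LessThan)
  finally show ?thesis
    by (simp only: x_def p_def)
qed

section \<open>Occurrences of words in the fixed point\<close>

definition occurs :: "nat list \<Rightarrow> nat \<Rightarrow> bool" where
  "occurs w z \<longleftrightarrow> (\<forall>i<length w. s (z + i) = w ! i)"

lemma occurs_append: "occurs (u @ v) z \<longleftrightarrow> occurs u z \<and> occurs v (z + length u)"
proof (intro iffI conjI)
  assume *: "occurs (u @ v) z"
  show "occurs u z"
    unfolding occurs_def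
  proof (intro allI impI)
    fix i
    assume "i < length u"
    then show "s (z + i) = u ! i"
      using *[unfolded occurs_def, rule_format, of i] by (simp add: nth_append)
  qed
  show "occurs v (z + length u)"
    unfolding occurs_def
  proof (intro allI impI)
    fix i
    assume "i < length v"
    then show "s (z + length u + i) = v ! i"
      using *[unfolded occurs_def, rule_format, of "length u + i"] by (simp add: nth_append add.assoc)
  qed
next
  assume *: "occurs u z \<and> occurs v (z + length u)"
  show "occurs (u @ v) z"
    unfolding occurs_def
  proof (intro allI impI)
    fix i
    assume i: "i < length (u @ v)"
    show "s (z + i) = (u @ v) ! i"
    proof (cases "i < length u")
      case True
      then show ?thesis
        using * by (simp add: occurs_def nth_append)
    next
      case False
      then have "i - length u < length v"
        using i by simp
      moreover have "\<forall>j<length v. s (z + length u + j) = v ! j"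
        using * by (simp add: occurs_def)
      ultimately have "s (z + length u + (i - length u)) = v ! (i - length u)"
        by blast
      then show ?thesis
        using False by (simp add: nth_append)
    qed
  qed
qed

lemma occurs_A_0: "occurs (A k) 0"
  unfolding occurs_def
proof (intro allI impI)
  fix i
  assume i: "i < length (A k)"
  have "A (k + d) ! i = A k ! i" for d
  proof (induction d)
    case (Suc d)
    have "i < length (A (k + d))"
      using i by (induction d) (simp_all add: A_Suc)
    then show ?case
      using Suc by (simp add: A_Suc nth_append)
  qed simp
  \<comment> \<open>The level \<open>max i k\<close> is at least \<open>k\<close>, so that
    \<open>A k\<close> is a prefix, and at least \<open>i\<close>, as \<open>s_limit\<close>
    requires.\<close>
  then have "A (k + (max i k - k)) ! i = A k ! i" .
  then show "s (0 + i) = A k ! i"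
    using s_limit(2)[of i "max i k"] by (simp add: A_def)
qed

context
  fixes k z :: nat
  assumes occ: "occurs (A (k + 2)) z"
begin

text \<open>Factors of the block \<open>A B A A A B A\<close>: those that
  \<open>s_shift_A_diff\<close> compares at distance \<open>length (A k)\<close>, and the square
  \<open>A A\<close>.\<close>

lemma occurs_factors:
  "occurs (A k @ B k) z"
  "occurs (B k @ A k) (z + length (A k))"
  "occurs (A k @ A k) (z + length (A k) + length (B k))"
  "occurs (A k) (z + 2 * length (A k) + length (B k))"
  "occurs (A k) (z + length (A k) + length (B k))"
  "occurs (A k) (z + 3 * length (A k) + length (B k))"
  "occurs (A k @ B k) (z + 3 * length (A k) + length (B k))"
  "occurs (B k @ A k) (z + 4 * length (A k) + length (B k))"
  using occ by (simp_all add: A_Suc B_Suc occurs_append numeral_eq_Suc ac_simps)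

text \<open>The bound on \<open>i\<close> keeps \<open>i + p\<close> inside the block. The shift
  compares \<open>A B\<close> with \<open>B A\<close> at both ends and \<open>A\<close> with
  \<open>A\<close> twice in between, so only the two swaps show up.\<close>

lemma s_shift_A_diff:
  fixes p q g
  defines "p \<equiv> length (A k)" and "q \<equiv> length (B k)" and "g \<equiv> length (pre k)"
  assumes "i < 4 * p + 2 * q"
  shows "int (s (z + i + p)) - int (s (z + i)) =
    (-1) ^ k * (of_bool (i = g + 1) - of_bool (i = g) +
      of_bool (i = 3 * p + q + g + 1) - of_bool (i = 3 * p + q + g))"
proof -
  have g: "p + q = 2 * g + 2"
    unfolding p_def q_def g_def by (rule length_pre)
  have eq: "s (y + j) = w ! j" if "occurs w y" "j < length w" for w y j
    using that by (simp add: occurs_def)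
  consider "i < p + q" | "p + q \<le> i" "i < 2 * p + q" | "2 * p + q \<le> i" "i < 3 * p + q" | "3 * p + q \<le> i"
    by linarith
  then show ?thesis
  proof cases
    case 1
    have "s (z + i) = (A k @ B k) ! i" "s (z + p + i) = (B k @ A k) ! i"
      using eq[OF occurs_factors(1), of i] eq[OF occurs_factors(2), of i] 1 by (simp_all add: p_def q_def)
    then show ?thesis
      using nth_A_B_diff[of i k] 1 by (simp add: p_def q_def g_def ac_simps)
  next
    case 2
    have "s (z + i) = A k ! (i - (p + q))" "s (z + i + p) = A k ! (i - (p + q))"
      using eq[OF occurs_factors(5), of "i - (p + q)"] eq[OF occurs_factors(4), of "i - (p + q)"] 2
      by (simp_all add: p_def q_def ac_simps)
    then show ?thesis
      using 2 g by simp
  next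
    case 3
    have "s (z + i) = A k ! (i - (2 * p + q))" "s (z + i + p) = A k ! (i - (2 * p + q))"
      using eq[OF occurs_factors(4), of "i - (2 * p + q)"] eq[OF occurs_factors(6), of "i - (2 * p + q)"] 3
      by (simp_all add: p_def q_def ac_simps)
    then show ?thesis
      using 3 g by simp
  next
    case 4
    define j where "j = i - (3 * p + q)"
    have ij: "i = 3 * p + q + j"
      using 4 by (simp add: j_def)
    have j: "j < p + q"
      using assms(4) by (simp add: ij)
    have "s (z + i) = (A k @ B k) ! j" "s (z + i + p) = (B k @ A k) ! j"
      using eq[OF occurs_factors(7), of j] eq[OF occurs_factors(8), of j] j
      by (simp_all add: p_def q_def ij ac_simps)
    then show ?thesis
      using nth_A_B_diff[of j k] j g
      by (simp add: p_def[symmetric] q_def[symmetric] g_def[symmetric] ij algebra_simps)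
  qed
qed

end

text \<open>The run is extended to a globally periodic sequence, to which
  \<open>hankel_period\<close> applies.\<close>

lemma hankel_locally_periodic:
  assumes per: "\<And>j. L \<le> j \<Longrightarrow> j \<le> R \<Longrightarrow> x (j + p) = x j" and p: "odd p"
    and c: "L \<le> c" "c + p \<le> R + 2" and c': "L \<le> c'" "c' + p \<le> R + 2"
  shows "hankel x c p = hankel x c' p"
proof -
  \<comment> \<open>\<open>L * (p - 1)\<close> is congruent to \<open>- L\<close> modulo
    \<open>p\<close>; adding it avoids a subtraction that would be truncated for
    \<open>j < L\<close>.\<close>
  define y where "y j = x (L + (j + L * (p - 1)) mod p)" for j
  have "p > 0"
    using p by (rule odd_pos)
  have x: "x (L + d) = x (L + d mod p)" if "L + d \<le> R + p" for d
    using that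
  proof (induction d rule: less_induct)
    case (less d)
    show ?case
    proof (cases "d < p")
      case False
      then have "x (L + d) = x (L + (d - p))"
        using per[of "L + (d - p)"] less.prems by simp
      also have "\<dots> = x (L + (d - p) mod p)"
        using less.IH[of "d - p"] less.prems False \<open>p > 0\<close> by simp
      finally show ?thesis
        using False by (simp add: le_mod_geq)
    qed simp
  qed
  have xy: "x j = y j" if "L \<le> j" "j \<le> R + p" for j
  proof -
    have "j + L * (p - 1) = (j - L) + L * p"
      using \<open>p > 0\<close> that by (cases p) (simp_all add: algebra_simps)
    then have "y j = x (L + (j - L) mod p)"
      by (simp add: y_def)
    then show ?thesis
      using x[of "j - L"] that by simp
  qed
  have hxy: "hankel x c p = hankel y c p" if "L \<le> c" "c + p \<le> R + 2" for c
    using that by (intro detf_cong xy) auto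
  have "y (j + p) = y j" for j
  proof -
    have "j + p + L * (p - 1) = (j + L * (p - 1)) + p"
      by simp
    then show ?thesis
      unfolding y_def by (simp only: mod_add_self2)
  qed
  then have "hankel y c p = hankel y 0 p" for c
    using p by (rule hankel_period)
  then show ?thesis
    using hxy[OF c] hxy[OF c'] by simp
qed

subsection \<open>The numeration system\<close>

text \<open>Joins the two recurrences. Below a digit 1 at \<open>i\<close>, the nonzero digits have
  indices under that of the second term (\<open>admissible_gap\<close>). At \<open>i = 0\<close>
  truncation yields \<open>f 1 = f 0 + f 0\<close>.\<close>

lemma f_Suc: "f (Suc i) = f i + f (if even i then i - 2 else i - 1)"
proof (cases "even i")
  case True
  then obtain j where "i = 2 * j"
    by blast
  show ?thesis
  proof (cases j)
    case 0
    then show ?thesis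
      using \<open>i = 2 * j\<close> by (simp add: f_0 f_1[unfolded One_nat_def])
  next
    case (Suc j')
    then have "Suc i = 2 * j' + 3" "i - 2 = 2 * j'" "i = 2 * j' + 2"
      using \<open>i = 2 * j\<close> by simp_all
    then show ?thesis
      using f_odd_rec[of j'] True by (simp only: if_True add.commute)
  qed
next
  case False
  then obtain j where "i = 2 * j + 1"
    by (blast elim: oddE)
  then show ?thesis
    using f_even_rec[of j] by simp
qed

lemma f_pos: "f i > 0"
proof (induction i)
  case (Suc i)
  then show ?case
    by (simp add: f_Suc)
qed (simp add: f_0)

lemma strict_mono_f: "strict_mono f"
  unfolding strict_mono_Suc_iff using f_Suc f_pos by simp

lemma less_f: "n < f n"
proof (induction n)
  case (Suc n)
  then show ?case
    using strict_monoD[OF strict_mono_f, of n "Suc n"] by simp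
qed (simp add: f_0)

section \<open>Existence and uniqueness of the representations\<close>

definition admissible :: "(nat \<Rightarrow> nat) \<Rightarrow> bool" where
  "admissible a \<longleftrightarrow> (\<forall>i. a i \<in> {0, 1}) \<and> finite {i. a i \<noteq> 0} \<and>
     (\<forall>i. a i * a (i + 1) = 0) \<and> (\<forall>i. even i \<longrightarrow> a i * a (i + 2) = 0)"

lemma is_representation_iff:
  assumes "\<And>i. N \<le> i \<Longrightarrow> a i = 0"
  shows "is_representation a n \<longleftrightarrow> admissible a \<and> n = (\<Sum>i<N. a i * f i)"
proof -
  have "{i. a i \<noteq> 0} \<subseteq> {..<N}"
    using assms by (metis (mono_tags, lifting) lessThan_iff mem_Collect_eq not_less subsetI)
  then have "(\<Sum>i | a i \<noteq> 0. a i * f i) = (\<Sum>i<N. a i * f i)"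
    by (intro sum.mono_neutral_left) auto
  then show ?thesis
    by (auto simp: is_representation_def admissible_def)
qed

lemma is_representationD:
  assumes "is_representation a n"
  shows "admissible a" and "\<exists>N. (\<forall>i\<ge>N. a i = 0) \<and> n = (\<Sum>i<N. a i * f i)"
proof -
  show "admissible a"
    using assms by (simp add: is_representation_def admissible_def)
  have "finite {i. a i \<noteq> 0}"
    using assms by (simp add: is_representation_def)
  then obtain N where bound: "\<forall>i\<in>{i. a i \<noteq> 0}. i < N"
    using finite_nat_set_iff_bounded by blast
  have N: "a i = 0" if "N \<le> i" for i
    using bspec[OF bound, of i] that by (cases "a i = 0") auto
  with assms show "\<exists>N. (\<forall>i\<ge>N. a i = 0) \<and> n = (\<Sum>i<N. a i * f i)"
    using is_representation_iff[of N a n, OF N] by blast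
qed

lemma admissible_01: "admissible a \<Longrightarrow> a i = 0 \<or> a i = 1"
  by (simp add: admissible_def)

lemma admissible_gap:
  assumes a: "admissible a" and i: "a i = 1" and l: "(if even i then i - 2 else i - 1) \<le> l" "l < i"
  shows "a l = 0"
proof -
  have "a l * a (l + 1) = 0" "even l \<Longrightarrow> a l * a (l + 2) = 0"
    using a by (simp_all add: admissible_def)
  moreover have "i = l + 1 \<or> i = l + 2 \<and> even l"
  proof (cases "even i")
    case True
    then have "i = l + 1 \<or> i = l + 2"
      using l by auto
    then show ?thesis
      using True by auto
  qed (use l in auto)
  ultimately show ?thesis
    using i by auto
qed

text \<open>A digit 1 at \<open>i\<close> confines the lower nonzero digits so much that they sum to
  less than the second term of \<open>f_Suc\<close>.\<close>

lemma admissible_sum_less: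
  assumes a: "admissible a"
  shows "(\<Sum>i<n. a i * f i) < f n"
proof (induction n rule: less_induct)
  case (less n)
  show ?case
  proof (cases n)
    case (Suc i)
    define l where "l = (if even i then i - 2 else i - 1)"
    have li: "l \<le> i"
      by (simp add: l_def)
    have f: "f n = f i + f l"
      by (simp add: Suc f_Suc l_def)
    show ?thesis
    proof (cases "a i = 0")
      case True
      then show ?thesis
        using less.IH[of i] f by (simp add: Suc)
    next
      case False
      then have i: "a i = 1"
        using admissible_01[OF a, of i] by simp
      have "(\<Sum>i<i. a i * f i) = (\<Sum>i<l. a i * f i)"
        using li admissible_gap[OF a i] by (intro sum.mono_neutral_right) (auto simp: l_def)
      then show ?thesis
        using less.IH[of l] li f i by (simp add: Suc)
    qed
  qed (simp add: f_pos)
qed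

lemma admissible_unique:
  assumes a: "admissible a" and b: "admissible b"
    and eq: "(\<Sum>i<n. a i * f i) = (\<Sum>i<n. b i * f i)" and i: "i < n"
  shows "a i = b i"
  using eq i
proof (induction n)
  case (Suc n)
  have "a n = b n"
    using Suc.prems(1) admissible_sum_less[OF a, of n] admissible_sum_less[OF b, of n]
      admissible_01[OF a, of n] admissible_01[OF b, of n] by auto
  then show ?case
    using Suc by (cases "i = n") auto
qed simp

lemma is_representation_unique:
  assumes "is_representation a n" "is_representation b n"
  shows "a = b"
proof -
  obtain N M where N: "\<forall>i\<ge>N. a i = 0" and M: "\<forall>i\<ge>M. b i = 0"
    using is_representationD(2) assms by metis
  then have "n = (\<Sum>i<max N M. a i * f i)" "n = (\<Sum>i<max N M. b i * f i)"
    using assms is_representation_iff[of "max N M" a n] is_representation_iff[of "max N M" b n] by simp_all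
  then have "a i = b i" if "i < max N M" for i
    using admissible_unique[OF is_representationD(1)[OF assms(1)] is_representationD(1)[OF assms(2)],
        of "max N M" i] that
    by simp
  then show ?thesis
    using N M by (metis ext max.cobounded1 max.cobounded2 not_less order_trans)
qed

lemma admissible_upd:
  assumes a: "admissible a" and z: "\<And>l. (if even i then i - 2 else i - 1) \<le> l \<Longrightarrow> a l = 0"
  shows "admissible (a(i := 1))"
proof -
  let ?b = "a(i := 1)"
  have zi: "a l = 0" if "i \<le> l" for l
    using z[of l] that by (cases "even i") auto
  show ?thesis
    unfolding admissible_def
  proof (intro conjI allI impI)
    fix l
    show "?b l \<in> {0, 1}"
      using a by (simp add: admissible_def)
    have "{l. ?b l \<noteq> 0} \<subseteq> insert i {l. a l \<noteq> 0}"
      by auto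
    moreover have "finite (insert i {l. a l \<noteq> 0})"
      using a by (simp add: admissible_def)
    ultimately show "finite {l. ?b l \<noteq> 0}"
      by (rule finite_subset)
    have "a l * a (l + 1) = 0"
      using a by (simp only: admissible_def)
    moreover have "a (l + 1) = 0" if "l = i"
      using zi[of "l + 1"] that by simp
    moreover have "a l = 0" if "l + 1 = i"
      using z[of l] that by auto
    ultimately show "?b l * ?b (l + 1) = 0"
      by (cases "l = i"; cases "l + 1 = i") simp_all
    assume l: "even l"
    then have "a l * a (l + 2) = 0"
      using a by (simp only: admissible_def)
    moreover have "a (l + 2) = 0" if "l = i"
      using zi[of "l + 2"] that by simp
    moreover have "a l = 0" if "l + 2 = i"
      using z[of l] l that by auto
    ultimately show "?b l * ?b (l + 2) = 0"
      by (cases "l = i"; cases "l + 2 = i") simp_all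
  qed
qed

text \<open>The greedy algorithm: once \<open>f i\<close> is subtracted, \<open>f_Suc\<close> bounds
  the remainder so that its digits keep the gap required below \<open>i\<close>.\<close>

lemma ex_admissible:
  assumes "n < f N"
  shows "\<exists>a. admissible a \<and> (\<forall>i\<ge>N. a i = 0) \<and> (\<Sum>i<N. a i * f i) = n"
  using assms
proof (induction N arbitrary: n rule: less_induct)
  case (less N)
  show ?case
  proof (cases N)
    case 0
    then show ?thesis
      using less.prems by (intro exI[of _ "\<lambda>_. 0"]) (simp add: f_0 admissible_def)
  next
    case (Suc i)
    show ?thesis
    proof (cases "n < f i")
      case True
      then obtain a where "admissible a" "\<forall>l\<ge>i. a l = 0" "(\<Sum>l<i. a l * f l) = n"
        using less.IH[of i] Suc by auto
      then show ?thesis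
        using Suc by (intro exI[of _ a]) simp
    next
      case False
      define l where "l = (if even i then i - 2 else i - 1)"
      have li: "l \<le> i"
        by (simp add: l_def)
      have "n - f i < f l"
        using less.prems False by (simp add: Suc f_Suc l_def)
      then obtain a where a: "admissible a" "\<forall>j\<ge>l. a j = 0" "(\<Sum>j<l. a j * f j) = n - f i"
        using less.IH[of l "n - f i"] Suc li by auto
      have "admissible (a(i := 1))"
        using a(1,2) by (intro admissible_upd) (auto simp: l_def)
      moreover have "\<forall>j\<ge>N. (a(i := 1)) j = 0"
        using a(2) li by (simp add: Suc)
      moreover have "(\<Sum>j<i. (a(i := 1)) j * f j) = (\<Sum>j<l. a j * f j)"
        using a(2) li by (intro sum.mono_neutral_cong_right) auto
      then have "(\<Sum>j<N. (a(i := 1)) j * f j) = n"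
        using a(3) False by (simp add: Suc)
      ultimately show ?thesis
        by blast
    qed
  qed
qed

lemma is_representation_digit: "is_representation (digit n) n"
proof -
  obtain a where "admissible a" "\<forall>i\<ge>n. a i = 0" "(\<Sum>i<n. a i * f i) = n"
    using ex_admissible[OF less_f] by blast
  then have "is_representation a n"
    using is_representation_iff[of n a n] by simp
  then have "\<exists>!a. is_representation a n"
    using is_representation_unique by blast
  then show ?thesis
    unfolding digit_def by (rule theI')
qed

lemma digit_eqI: "is_representation a n \<Longrightarrow> digit n = a"
  using is_representation_digit is_representation_unique by blast

text \<open>The pairs of digits with indices \<open>2 * i\<close>, \<open>2 * i + 1\<close> form a Dumont--Thomas expansion: they
  select one of the three letters of \<open>tau [1]\<close>, and a digit \<open>1\<close> at \<open>2 * i\<close> selects the letter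
  \<open>0\<close>, in whose image there is no choice left.\<close>

lemma admissible_occurs:
  assumes a: "admissible a" and J: "\<And>i. 2 * J \<le> i \<Longrightarrow> a i = 0" and "i \<le> J"
  shows "occurs (if a (2 * i) = 1 then B i else A i) (\<Sum>l=2*i..<2*J. a l * f l)"
  using \<open>i \<le> J\<close>
\<comment> \<open>The induction descends from \<open>J\<close>, where the sum is empty and
  \<open>A J\<close> is a prefix of \<open>s\<close>.\<close>
proof (induction rule: inc_induct)
  case base
  then show ?case
    using J[of "2 * J"] occurs_A_0 by simp
next
  case (step i)
  define z where "z = (\<Sum>l=2*Suc i..<2*J. a l * f l)"
  have z: "(\<Sum>l=2*i..<2*J. a l * f l) = z + (a (2 * i) * f (2 * i) + a (2 * i + 1) * f (2 * i + 1))"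
    using step.hyps by (simp add: z_def sum.atLeast_Suc_lessThan)
  have IH: "occurs (if a (2 * Suc i) = 1 then B (Suc i) else A (Suc i)) z"
    unfolding z_def by (rule step.IH)
  show ?case
  proof (cases "a (2 * Suc i) = 1")
    case True
    then have "a (2 * i) = 0" "a (2 * i + 1) = 0"
      using admissible_gap[OF a True, of "2 * i"] admissible_gap[OF a True, of "2 * i + 1"] by simp_all
    then show ?thesis
      using IH True by (simp add: z B_Suc)
  next
    case False
    \<comment> \<open>The digit pairs \<open>(0, 0)\<close>, \<open>(1, 0)\<close> and
      \<open>(0, 1)\<close> select the first \<open>A i\<close>, the \<open>B i\<close> and the
      second \<open>A i\<close>.\<close>
    then have "occurs (A i) z" "occurs (B i) (z + length (A i))" "occurs (A i) (z + length (A i) + length (B i))"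
      using IH by (simp_all add: A_Suc occurs_append)
    moreover have "a (2 * i) = 0 \<or> a (2 * i + 1) = 0"
      using a by (auto simp: admissible_def)
    moreover note admissible_01[OF a, of "2 * i"] admissible_01[OF a, of "2 * i + 1"]
    moreover have "f (2 * i + 1) = length (A i) + length (B i)"
      by (rule length_A_B[symmetric])
    ultimately show ?thesis
      unfolding z length_A[symmetric] by (auto simp: add.assoc)
  qed
qed

section \<open>The truncated sums \<open>Phi\<close>\<close>

lemma Phi_cases:
  assumes "Phi K x < f (2 * K + 2)"
  shows "digit x (2 * K + 2) = 0" and "Phi K x = (\<Sum>i<2 * K + 2. digit x i * f i)"
proof -
  have a: "admissible (digit x)"
    by (rule is_representationD(1)[OF is_representation_digit])
  have Phi: "Phi K x = (\<Sum>i<2 * K + 2. digit x i * f i) + digit x (2 * K + 2) * f (2 * K + 2)"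
    unfolding Phi_def by (simp flip: lessThan_Suc_atMost)
  \<comment> \<open>A digit 1 there would alone contribute \<open>f (2 * K + 2)\<close>.\<close>
  then show "digit x (2 * K + 2) = 0"
    using assms admissible_01[OF a, of "2 * K + 2"] by auto
  then show "Phi K x = (\<Sum>i<2 * K + 2. digit x i * f i)"
    using Phi by simp
qed

text \<open>As the digit at \<open>2 * K + 2\<close> is 0, the digits below it can be exchanged for
  those of \<open>Phi K x - d\<close> without violating a condition across that index.\<close>

lemma Phi_diff:
  assumes "Phi K x < f (2 * K + 2)" "d \<le> Phi K x"
  shows "Phi K (x - d) = Phi K x - d"
proof -
  let ?a = "digit x" and ?M = "2 * K + 2"
  have a: "admissible ?a"
    by (rule is_representationD(1)[OF is_representation_digit])
  obtain N0 where N0: "\<forall>i\<ge>N0. ?a i = 0" and x0: "x = (\<Sum>i<N0. ?a i * f i)"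
    using is_representationD(2)[OF is_representation_digit] by blast
  define N where "N = max N0 (?M + 1)"
  have N: "\<And>i. N \<le> i \<Longrightarrow> ?a i = 0"
    using N0 by (simp add: N_def)
  have x: "x = (\<Sum>i<N. ?a i * f i)"
    using is_representation_iff[of N ?a x, OF N] is_representation_digit[of x] by blast
  have "Phi K x - d < f ?M"
    using assms(1) by linarith
  then obtain b where b: "admissible b" "\<forall>i\<ge>?M. b i = 0" "(\<Sum>i<?M. b i * f i) = Phi K x - d"
    using ex_admissible by blast
  define c where "c i = (if i < ?M then b i else ?a i)" for i
  have top: "c ?M = 0"
    using Phi_cases(1)[OF assms(1)] by (simp add: c_def)
  have c0: "c i = 0" if "N \<le> i" for i
    using N that by (simp add: c_def N_def)
  have "admissible c"
    unfolding admissible_def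
  proof (intro conjI allI impI)
    fix i
    show "c i \<in> {0, 1}"
      using a b(1) by (simp add: c_def admissible_def)
    have "{i. c i \<noteq> 0} \<subseteq> {i. ?a i \<noteq> 0} \<union> {i. b i \<noteq> 0}"
      by (auto simp: c_def)
    then show "finite {i. c i \<noteq> 0}"
      using a b(1) by (auto simp: admissible_def intro: finite_subset)
    have A: "?a i * ?a (i + 1) = 0" "b i * b (i + 1) = 0"
      using a b(1) by (simp_all only: admissible_def)
    show "c i * c (i + 1) = 0"
    proof (cases "i + 1 = ?M")
      case True
      then show ?thesis using top by simp
    next
      case False
      then have "i < ?M \<longleftrightarrow> i + 1 < ?M"
        by linarith
      then show ?thesis
        using A by (cases "i < ?M") (simp_all only: c_def if_True if_False)
    qed
    assume "even i"
    then have A: "?a i * ?a (i + 2) = 0" "b i * b (i + 2) = 0"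
      using a b(1) by (simp_all only: admissible_def)
    show "c i * c (i + 2) = 0"
    proof (cases "i + 2 = ?M")
      case True
      then show ?thesis using top by simp
    next
      case False
      \<comment> \<open>Otherwise \<open>i\<close> would be \<open>2 * K + 1\<close>, which is
        odd.\<close>
      then have "i < ?M \<longleftrightarrow> i + 2 < ?M"
        using \<open>even i\<close> by presburger
      then show ?thesis
        using A by (cases "i < ?M") (simp_all only: c_def if_True if_False)
    qed
  qed
  moreover have "x - d = (\<Sum>i<N. c i * f i)"
  proof -
    have split: "(\<Sum>i<N. h i) = (\<Sum>i<?M. h i) + (\<Sum>i\<in>{?M..<N}. h i)" for h :: "nat \<Rightarrow> nat"
    proof -
      have "{..<N} = {..<?M} \<union> {?M..<N}"
        by (auto simp: N_def)
      then show ?thesis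
        by (simp add: sum.union_disjoint ivl_disj_int)
    qed
    have "(\<Sum>i<N. c i * f i) = (\<Sum>i<?M. b i * f i) + (\<Sum>i\<in>{?M..<N}. ?a i * f i)"
      unfolding split by (simp add: c_def)
    also have "\<dots> = Phi K x - d + (\<Sum>i\<in>{?M..<N}. ?a i * f i)"
      by (simp only: b(3))
    moreover have "x = Phi K x + (\<Sum>i\<in>{?M..<N}. ?a i * f i)"
      using x unfolding split Phi_cases(2)[OF assms(1)] .
    ultimately show ?thesis
      using assms(2) by linarith
  qed
  ultimately have "is_representation c (x - d)"
    using is_representation_iff[of N c "x - d", OF c0] by blast
  then have "digit (x - d) = c"
    by (rule digit_eqI)
  then have "Phi K (x - d) = (\<Sum>i<?M. c i * f i) + c ?M * f ?M"
    unfolding Phi_def by (simp flip: lessThan_Suc_atMost)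
  also have "(\<Sum>i<?M. c i * f i) = (\<Sum>i<?M. b i * f i)"
    by (simp add: c_def)
  finally show ?thesis
    using top b(3) by simp
qed

text \<open>Makes \<open>Phi_cases\<close> and \<open>Phi_diff\<close> applicable to the elements of
  \<open>E' K\<close>.\<close>

lemma f_odd_half_less: "f (2 * K + 3) div 2 < f (2 * K + 2)"
  using f_odd_rec[of K] strict_monoD[OF strict_mono_f, of "2 * K" "2 * K + 2"] by simp

subsection \<open>Hankel determinants on the window\<close>

text \<open>Guarantees that \<open>enumerate\<close> stays inside \<open>E' K\<close>. To the digits
  of \<open>f (2 * K + 3) div 2\<close> a digit 1 can be added at any index from
  \<open>2 * K + 4\<close> on.\<close>

lemma infinite_E': "infinite (E' K)"
proof -
  let ?M = "2 * K + 2"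
  obtain b where b: "admissible b" "\<forall>i\<ge>?M. b i = 0" "(\<Sum>i<?M. b i * f i) = f (2 * K + 3) div 2"
    using ex_admissible[OF f_odd_half_less] by blast
  have "\<exists>x>J. x \<in> E' K" if J: "J \<ge> 2 * K + 4" for J
  proof (intro exI conjI)
    define c where "c = b(J := 1)"
    let ?x = "\<Sum>i<Suc J. c i * f i"
    have "b l = 0" if "(if even J then J - 2 else J - 1) \<le> l" for l
    proof -
      have "?M \<le> l"
        using that J by (cases "even J") auto
      then show ?thesis
        using b(2) by blast
    qed
    then have c: "admissible c"
      unfolding c_def by (rule admissible_upd[OF b(1)])
    have c0: "c i = 0" if "Suc J \<le> i" for i
      using b(2) J that by (simp add: c_def)
    have "is_representation c ?x"
      using is_representation_iff[of "Suc J" c ?x, OF c0] c by blast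
    then have "digit ?x = c"
      by (rule digit_eqI)
    then have "Phi K ?x = (\<Sum>i<?M. c i * f i) + c ?M * f ?M"
      unfolding Phi_def by (simp flip: lessThan_Suc_atMost)
    also have "(\<Sum>i<?M. c i * f i) = (\<Sum>i<?M. b i * f i)"
      using J by (intro sum.cong) (auto simp: c_def)
    also have "c ?M = 0"
      using b(2) J by (simp add: c_def)
    finally have "Phi K ?x = f (2 * K + 3) div 2"
      using b(3) by linarith
    then show "?x \<in> E' K"
      by (simp only: E'_def mem_Collect_eq)
    have "f J \<le> ?x"
      by (simp add: c_def)
    then show "J < ?x"
      using less_f[of J] by linarith
  qed
  then have "\<exists>x>m. x \<in> E' K" for m
    by (metis add_leD1 le_add2 less_le_trans le_less_trans)
  then show ?thesis
    by (simp add: infinite_nat_iff_unbounded)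
qed

text \<open>The digits from \<open>2 * K + 2\<close> on locate a block by
  \<open>admissible_occurs\<close>, an \<open>A (K + 1)\<close> because the lowest of them is 0; the
  remaining digits sum to the offset.\<close>

lemma E'_occurs:
  assumes "x \<in> E' K"
  shows "f (2 * K + 3) div 2 \<le> x" and "occurs (A (K + 1)) (x - f (2 * K + 3) div 2)"
proof -
  let ?a = "digit x" and ?M = "2 * K + 2"
  have a: "admissible ?a"
    by (rule is_representationD(1)[OF is_representation_digit])
  have Phi: "Phi K x = f (2 * K + 3) div 2"
    using assms by (simp add: E'_def)
  then have less: "Phi K x < f ?M"
    using f_odd_half_less[of K] by simp
  obtain N where N: "\<forall>i\<ge>N. ?a i = 0"
    using is_representationD(2)[OF is_representation_digit] by blast
  define J where "J = max N (K + 1)"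
  have J: "?a i = 0" if "2 * J \<le> i" for i
  proof -
    have "N \<le> J"
      by (simp add: J_def)
    then have "N \<le> i"
      using that by linarith
    then show ?thesis
      using N by blast
  qed
  have "K + 1 \<le> J"
    by (simp add: J_def)
  have "x = (\<Sum>i<2 * J. ?a i * f i)"
    using is_representation_iff[of "2 * J" ?a x, OF J] is_representation_digit[of x] by blast
  also have "{..<2 * J} = {..<?M} \<union> {?M..<2 * J}"
    using \<open>K + 1 \<le> J\<close> by auto
  also have "(\<Sum>i\<in>{..<?M} \<union> {?M..<2 * J}. ?a i * f i) =
      (\<Sum>i<?M. ?a i * f i) + (\<Sum>i=?M..<2 * J. ?a i * f i)"
    by (intro sum.union_disjoint) auto
  also have "(\<Sum>i<?M. ?a i * f i) = f (2 * K + 3) div 2"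
    using Phi_cases(2)[OF less] Phi by simp
  finally have x: "x = f (2 * K + 3) div 2 + (\<Sum>i=?M..<2 * J. ?a i * f i)" .
  then show "f (2 * K + 3) div 2 \<le> x"
    by linarith
  have "occurs (if ?a (2 * (K + 1)) = 1 then B (K + 1) else A (K + 1)) (\<Sum>i=2 * (K + 1)..<2 * J. ?a i * f i)"
    by (rule admissible_occurs[OF a J]) (simp_all add: J_def)
  moreover have "2 * (K + 1) = ?M"
    by simp
  moreover have "x - f (2 * K + 3) div 2 = (\<Sum>i=?M..<2 * J. ?a i * f i)"
    using x by linarith
  ultimately show "occurs (A (K + 1)) (x - f (2 * K + 3) div 2)"
    using Phi_cases(1)[OF less] by (simp only: zero_neq_one if_False)
qed

context
  fixes k z p q g :: nat
  assumes occ: "occurs (A (k + 2)) z"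
    and p: "p = length (A k)" and q: "q = length (B k)" and g: "g = length (pre k)"
begin

lemma length_A_pos: "p > 0"
  unfolding p using odd_length_A by (rule odd_pos)

lemma length_A_B_pre: "p + q = 2 * g + 2"
  unfolding p q g by (rule length_pre)

lemmas s_shift_p = s_shift_A_diff[OF occ, folded p q g]

lemma s_periodic:
  assumes "z + g + 2 \<le> j" "j \<le> z + 3 * p + q + g - 1"
  shows "int (s (j + p)) = int (s j)"
proof -
  define i where "i = j - z"
  have "i < 4 * p + 2 * q" "i \<noteq> g" "i \<noteq> g + 1" "i \<noteq> 3 * p + q + g" "i \<noteq> 3 * p + q + g + 1"
    using assms length_A_pos length_A_B_pre by (simp_all add: i_def)
  then have "int (s (z + i + p)) - int (s (z + i)) = 0"
    using s_shift_p[of i] by simp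
  moreover have "z + i = j"
    using assms(1) by (simp add: i_def)
  ultimately show ?thesis
    by simp
qed

text \<open>Within the run the start can be moved to the square \<open>A A\<close> at
  \<open>z + p + q\<close>, where the entries are read cyclically from \<open>A k\<close>.\<close>

lemma hankel_periodic_part:
  assumes "z + g + 2 \<le> c" "c + p \<le> z + 3 * p + q + g + 1"
  shows "hankel (\<lambda>j. int (s j)) c p = (-1) ^ ((p - 1) div 2) * int (sum_list (A k))"
proof -
  have R: "z + 3 * p + q + g + 1 = (z + 3 * p + q + g - 1) + 2"
    using length_A_pos by simp
  have "hankel (\<lambda>j. int (s j)) c p = hankel (\<lambda>j. int (s j)) (z + p + q) p"
  proof (rule hankel_locally_periodic[where L = "z + g + 2" and R = "z + 3 * p + q + g - 1"])
    show "odd p"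
      unfolding p by (rule odd_length_A)
    show "z + g + 2 \<le> z + p + q" "z + p + q + p \<le> z + 3 * p + q + g - 1 + 2"
      using length_A_B_pre by linarith+
  qed (use assms R s_periodic in simp_all)
  also have "\<dots> = hankel (\<lambda>i. int (A k ! (i mod p))) 0 p"
  proof (rule detf_cong)
    fix i j
    assume ij: "i < p" "j < p"
    have "s (z + p + q + (i + j)) = (A k @ A k) ! (i + j)"
      using occurs_factors(3)[OF occ] ij by (simp add: occurs_def p q)
    also have "\<dots> = A k ! ((i + j) mod p)"
      using ij by (simp add: nth_append p le_mod_geq)
    finally show "int (s (z + p + q + i + j)) = int (A k ! ((0 + i + j) mod p))"
      by (simp add: add.assoc)
  qed
  also have "\<dots> = (-1) ^ ((p - 1) div 2) * int (sum_list (A k))"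
    unfolding p by (rule hankel_A)
  finally show ?thesis .
qed

text \<open>\<open>a\<close> and \<open>b\<close> are the corner sizes of
  \<open>hankel_frame\<close>. In the exponent, \<open>k * a\<close> and \<open>(k + 1) * b\<close>
  stem from the defects \<open>(-1) ^ k\<close> and \<open>- ((-1) ^ k)\<close>,
  \<open>(p - 1) div 2\<close> from \<open>hankel_A\<close>, and the rest from the corners.\<close>

lemma H_frame:
  assumes n: "n = p + a + b" and a: "a > 0 \<Longrightarrow> m + a = z + g + 2"
    and b: "b > 0 \<Longrightarrow> m + a + n = z + 3 * p + q + g + 1"
    and L: "z + g + 2 \<le> m + a" and R: "m + a + n \<le> z + 3 * p + q + g + 1"
  shows "H m n = (-1) ^ (b * (b - 1) div 2 + p * a + a * (a - 1) div 2 + k * a + (k + 1) * b + (p - 1) div 2) *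
    int (sum_list (A k))"
proof -
  let ?R = "z + 3 * p + q + g - 1"
  have R2: "z + 3 * p + q + g + 1 = ?R + 2" "Suc ?R = z + (3 * p + q + g)"
    using length_A_pos by simp_all
  have "hankel (\<lambda>j. int (s j)) m (p + a + b) =
    (-1) ^ (b * (b - 1) div 2 + p * a + a * (a - 1) div 2) * ((-1) ^ k) ^ a * (- ((-1) ^ k)) ^ b *
      hankel (\<lambda>j. int (s j)) (m + a) p"
  proof (rule hankel_frame[where L = "z + g + 2" and R = ?R])
    show "int (s (m + a - 1 + p)) - int (s (m + a - 1)) = (-1) ^ k" if "a > 0"
    proof -
      have "m + a - 1 = z + (g + 1)"
        using a that by simp
      then show ?thesis
        using s_shift_p[of "g + 1"] length_A_pos length_A_B_pre by simp
    qed
    show "int (s (Suc ?R + p)) - int (s (Suc ?R)) = - ((-1) ^ k)"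
      unfolding R2(2) using s_shift_p[of "3 * p + q + g"] length_A_pos length_A_B_pre by simp
  qed (use assms length_A_pos s_periodic R2(1) in simp_all)
  also have "hankel (\<lambda>j. int (s j)) (m + a) p = (-1) ^ ((p - 1) div 2) * int (sum_list (A k))"
    using L R n by (intro hankel_periodic_part) simp_all
  also have "(- ((-1) ^ k)) ^ b = (-1 :: int) ^ ((k + 1) * b)"
    unfolding power_mult by simp
  also have "((-1) ^ k) ^ a = (-1 :: int) ^ (k * a)"
    unfolding power_mult ..
  finally show ?thesis
    unfolding H_def n by (simp only: power_add mult_ac)
qed

lemma H_interior:
  assumes "p < n" "n + 1 < 3 * p + q" "z + g + 2 + p < m + n" "m + n \<le> z + 3 * p + q + g"
  shows "H m n = 0"
  unfolding H_def
  by (rule hankel_eq_0[where L = "z + g + 2" and R = "z + 3 * p + q + g - 1" and p = p])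
    (use assms length_A_pos length_A_B_pre s_periodic in simp_all)

end

section \<open>Parities of the sign exponents\<close>

lemma even_choose_2:
  fixes n :: nat
  shows "even (n * (n - 1) div 2) \<longleftrightarrow> n mod 4 = 0 \<or> n mod 4 = 1"
proof -
  define j where "j = n div 4"
  have "n = 4 * j + n mod 4" "n mod 4 < 4"
    by (simp_all add: j_def)
  then consider "n = 4 * j" | "n = 4 * j + 1" | "n = 4 * j + 2" | "n = 4 * j + 3"
    by linarith
  then show ?thesis
  proof cases
    case 1
    then have eq: "n * (n - 1) div 2 = 2 * (j * (n - 1))"
      by simp
    have "n mod 4 = 0"
      using 1 by presburger
    then show ?thesis
      unfolding eq by simp
  next
    case 2
    then have "n - 1 = 4 * j"
      by simp
    then have eq: "n * (n - 1) div 2 = 2 * (j * n)"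
      by simp
    have "n mod 4 = 1"
      using 2 by presburger
    then show ?thesis
      unfolding eq by simp
  next
    case 3
    then have "n * (n - 1) = 2 * ((2 * j + 1) * (4 * j + 1))"
      by simp
    moreover have "n mod 4 = 2"
      using 3 by presburger
    ultimately show ?thesis by simp
  next
    case 4
    then have "n * (n - 1) = 2 * ((4 * j + 3) * (2 * j + 1))"
      by (simp add: algebra_simps)
    moreover have "n mod 4 = 3"
      using 4 by presburger
    ultimately show ?thesis by simp
  qed
qed

text \<open>Expanding \<open>(2 w - a) (2 w - a - 1) / 2\<close> leaves
  \<open>a (a + 1) / 2 + w\<close> modulo 2.\<close>

lemma even_choose_2_complement:
  fixes a b w :: nat
  assumes "a + b = 2 * w"
  shows "even (b * (b - 1) div 2) \<longleftrightarrow> even (a * (a - 1) div 2 + a + w)"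
  unfolding even_add even_choose_2 using assms by presburger

theorem theorem1:
  fixes k m n :: nat
  assumes "(m, n) \<in> U k"
  shows "(n = f (2 * k + 3) - 1 \<longrightarrow>
      rat_of_int (H m n) =
        (-1) ^ (k + 1)
        * (-1) powi (int (f (2 * k + 5) div 2) - int (Phi (k + 1) (m + n)))
        * (rat_of_nat (f (2 * k + 1)) / 2))
    \<and> (n = f (2 * k) \<longrightarrow>
      rat_of_int (H m n) =
        (-1) ^ (k + 1) * (-1) ^ ((f (2 * k + 2) - 1) div 2)
        * (rat_of_nat (f (2 * k + 1)) / 2))
    \<and> (f (2 * k) < n \<and> n < f (2 * k + 3) - 1 \<longrightarrow>
      (if \<exists>i\<ge>1. int (m + n) = int (alpha k i) - int (f (2 * k + 2)) + 1 \<or> m + n = alpha k i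
       then rat_of_int (H m n) =
         - ((-1) ^ ((f (2 * k + 3) - n) * k)
            * (-1) ^ (((f (2 * k + 3) - 1 - n) * (f (2 * k + 3) - 2 - n)) div 2)
            * (rat_of_nat (f (2 * k + 1)) / 2))
       else H m n = 0))"
proof -
  define p q g h where "p = length (A k)" and "q = length (B k)" and "g = length (pre k)"
    and "h = f (2 * k + 5) div 2"
  obtain u where u: "p = 2 * u + 1"
    using odd_length_A[of k] unfolding p_def by (blast elim: oddE)
  have odd_p: "odd p" and pu: "(p - 1) div 2 = u"
    using u by simp_all
  have g: "p + q = 2 * g + 2"
    unfolding p_def q_def g_def by (rule length_pre)
  have gk: "even g \<longleftrightarrow> even k"
    unfolding g_def by (rule even_length_pre)
  have f0: "f (2 * k) = p" and f1: "f (2 * k + 1) = p + q"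
    unfolding p_def q_def length_A length_A_B[symmetric] by simp_all
  have f2: "f (2 * k + 2) = 2 * p + q"
    using f_even_rec[of k] unfolding f0 f1 by simp
  have f3: "f (2 * k + 3) = 3 * p + q"
    using f_odd_rec[of k] unfolding f0 f2 by simp
  have idx: "2 * (k + 1) = 2 * k + 2" "2 * k + 2 + 1 = 2 * k + 3" "2 * k + 2 + 2 = 2 * k + 4"
    "2 * k + 2 + 3 = 2 * k + 5" "k + 1 + 1 = k + 2"
    by simp_all
  have f4: "f (2 * k + 4) = 5 * p + 2 * q"
    using f_even_rec[of "k + 1"] unfolding idx f2 f3 by simp
  have "f (2 * k + 5) = 7 * p + 3 * q"
    using f_odd_rec[of "k + 1"] unfolding idx f2 f4 by simp
  then have h: "h = 3 * p + q + g + 1"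
    using g by (simp add: h_def)
  define r where "r = sum_list (A k)"
  have r: "rat_of_nat (f (2 * k + 1)) / 2 = rat_of_nat r"
  proof -
    have "f (2 * k + 1) = 2 * r"
      using sum_list_A_B[of k] length_A_B[of k] by (simp add: r_def)
    then show ?thesis by simp
  qed
  have alpha: "alpha k i \<in> E' (k + 1)" for i
    unfolding alpha_def by (rule enumerate_in_set[OF infinite_E'])
  have Phi: "Phi (k + 1) (alpha k i - d) = h - d" if "d \<le> h" for i d
  proof -
    have *: "Phi (k + 1) (alpha k i) = f (2 * (k + 1) + 3) div 2"
      using alpha[of i] by (simp only: E'_def mem_Collect_eq)
    then have "Phi (k + 1) (alpha k i) = h"
      unfolding idx h_def .
    moreover have "Phi (k + 1) (alpha k i) < f (2 * (k + 1) + 2)"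
      unfolding * by (rule f_odd_half_less)
    ultimately show ?thesis
      using Phi_diff[of "k + 1" "alpha k i" d] that by simp
  qed
  have alpha_h: "h \<le> alpha k i" "occurs (A (k + 2)) (alpha k i - h)" for i
    using E'_occurs[OF alpha[of i]] unfolding idx h_def .

  obtain i where i: "i \<ge> 1" "p \<le> n" "n < 3 * p + q" "alpha k i < m + n + (2 * p + q)" "m + n \<le> alpha k i"
    using assms unfolding U_def U_part_def f0 f2 f3 by auto
  define z where "z = alpha k i - h"
  have z: "alpha k i = z + 3 * p + q + g + 1"
    using alpha_h(1)[of i] by (simp add: z_def h)
  \<comment> \<open>The distance of \<open>m + n\<close> from the right end of its window, which
    \<open>Phi\<close> recovers as \<open>h - d\<close>.\<close>
  define d where "d = alpha k i - (m + n)"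
  have d: "d < 2 * p + q" "m + n = alpha k i - d" "m + n + d = alpha k i"
    using i by (simp_all add: d_def)
  have Phi_mn: "Phi (k + 1) (m + n) = h - d"
    using Phi[of d i] d h by simp
  have occ: "occurs (A (k + 2)) z"
    unfolding z_def by (rule alpha_h)
  note frame = H_frame[OF occ p_def q_def g_def, folded r_def]

  \<comment> \<open>The index on the left may belong to another window, but
    \<open>Phi (k + 1) (m + n)\<close> determines \<open>d\<close>, so an edge of any window is an
    edge of this one.\<close>
  have edges: "(\<exists>i\<ge>1. int (m + n) = int (alpha k i) - int (f (2 * k + 2)) + 1 \<or> m + n = alpha k i) \<longleftrightarrow>
    m + n = z + g + 2 + p \<or> m + n = alpha k i" (is "?l \<longleftrightarrow> ?r")
  proof
    assume ?l
    then obtain i' where "int (m + n) = int (alpha k i') - int (2 * p + q) + 1 \<or> m + n = alpha k i'"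
      unfolding f2 by blast
    then have "m + n = alpha k i' - (2 * p + q - 1) \<or> m + n = alpha k i' - 0"
      using u by linarith
    then have "h - d = h - (2 * p + q - 1) \<or> h - d = h - 0"
      using Phi[of "2 * p + q - 1" i'] Phi[of 0 i'] Phi_mn h by auto
    then have "d = 2 * p + q - 1 \<or> d = 0"
      using d(1) h by linarith
    then show ?r
      using d(2) z u by auto
  next
    assume ?r
    then have "int (m + n) = int (alpha k i) - int (f (2 * k + 2)) + 1 \<or> m + n = alpha k i"
      unfolding f2 using z by auto
    then show ?l
      using i(1) by blast
  qed

  have top: "rat_of_int (H m n) = (-1) ^ (k + 1) * (-1) powi (int h - int (Phi (k + 1) (m + n))) * rat_of_nat r"
    if n: "n = 3 * p + q - 1"
  proof -
    \<comment> \<open>On this side of the frame the corners have sizes \<open>d\<close> and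
      \<open>b\<close>; one of them may be empty.\<close>
    define b where "b = 2 * p + q - 1 - d"
    have ab: "d + b = 2 * (u + g + 1)"
      using d(1) u g by (simp add: b_def)
    note Xb = even_choose_2_complement[OF ab]
    have even_b: "even b \<longleftrightarrow> even d"
      using ab by presburger
    have "n + 1 = 3 * p + q"
      using n u by simp
    then have n': "n = p + d + b" and md: "m + d = z + g + 2"
      using ab u g d(3) z by auto
    have "H m n = (-1) ^ (b * (b - 1) div 2 + p * d + d * (d - 1) div 2 + k * d + (k + 1) * b + (p - 1) div 2) * int r"
    proof (rule frame)
      show "m + d + n = z + 3 * p + q + g + 1" "m + d + n \<le> z + 3 * p + q + g + 1"
        using d(3) z by auto
    qed (use n' md in auto)
    also have "(-1 :: int) ^ (b * (b - 1) div 2 + p * d + d * (d - 1) div 2 + k * d + (k + 1) * b + (p - 1) div 2) =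
        (-1) ^ (k + 1 + d)"
    proof -
      \<comment> \<open>\<open>Xb\<close> rewrites the first summand as
        \<open>d * (d - 1) div 2 + d + u + g + 1\<close> modulo 2. As \<open>p\<close> is odd,
        \<open>b\<close> has the parity of \<open>d\<close> and \<open>g\<close> that of
        \<open>k\<close>, all but \<open>k + 1 + d\<close> cancels.\<close>
      have "even (b * (b - 1) div 2 + p * d + d * (d - 1) div 2 + k * d + (k + 1) * b + (p - 1) div 2)
          \<longleftrightarrow> even (k + 1 + d)"
        unfolding even_add even_mult_iff Xb pu even_b gk using odd_p by auto
      then show ?thesis
        by (simp only: minus_one_power_iff)
    qed
    finally have "rat_of_int (H m n) = (-1) ^ (k + 1 + d) * rat_of_nat r"
      by simp
    moreover have "int h - int (Phi (k + 1) (m + n)) = int d"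
      using Phi_mn d h by simp
    ultimately show ?thesis
      by (simp add: power_add)
  qed
  have bottom: "rat_of_int (H m n) = (-1) ^ (k + 1) * (-1) ^ ((2 * p + q - 1) div 2) * rat_of_nat r"
    if n: "n = p"
  proof -
    \<comment> \<open>For \<open>n = p\<close> both corners are empty, and the window is just wide
      enough for the whole matrix to lie in the run.\<close>
    have "z + g + 2 \<le> m"
      using d(1,3) z n g by linarith
    moreover have "m + n \<le> z + 3 * p + q + g + 1"
      using d(3) z by linarith
    ultimately have "H m n = (-1) ^ u * int r"
      using frame[of n 0 0 m] n pu by simp
    moreover have "(2 * p + q - 1) div 2 = u + g + 1"
      using u g by simp
    moreover have "(-1 :: rat) ^ (k + 1 + (u + g + 1)) = (-1) ^ u"
      using gk by (simp add: minus_one_power_iff)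
    ultimately show ?thesis
      by (simp add: power_add)
  qed
  have side: "rat_of_int (H m n) =
      - ((-1) ^ ((3 * p + q - n) * k) * (-1) ^ (((3 * p + q - 1 - n) * (3 * p + q - 2 - n)) div 2) * rat_of_nat r)"
    if n: "p < n" "n < 3 * p + q - 1" and mn: "m + n = z + g + 2 + p \<or> m + n = alpha k i"
  proof -
    \<comment> \<open>The size of the only corner: the left one at the left edge of the window, the
      right one at the right edge. The stated exponents use the complement \<open>c\<close>.\<close>
    define t where "t = n - p"
    define c where "c = 3 * p + q - 1 - n"
    have tc: "t + c = 2 * (u + g + 1)" "n = p + t" "3 * p + q - n = c + 1" "3 * p + q - 2 - n = c - 1"
      using n u g by (simp_all add: t_def c_def)
    note Xc = even_choose_2_complement[OF tc(1)]
    have even_c: "even c \<longleftrightarrow> even t"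
      using tc(1) by presburger
    have "H m n = (-1) ^ (1 + (c + 1) * k + c * (c - 1) div 2) * int r"
      using mn
    proof
      assume mn: "m + n = z + g + 2 + p"
      have "m + t = z + g + 2"
        using mn tc(2) by simp
      then have "H m n = (-1) ^ (p * t + t * (t - 1) div 2 + k * t + u) * int r"
        using frame[of n t 0 m] tc(2) pu i(3) by simp
      moreover have "even (p * t + t * (t - 1) div 2 + k * t + u)
          \<longleftrightarrow> even (1 + (c + 1) * k + c * (c - 1) div 2)"
        unfolding even_add even_mult_iff Xc even_c gk using odd_p by auto
      ultimately show ?thesis
        by (simp only: minus_one_power_iff)
    next
      assume mn: "m + n = alpha k i"
      then have "z + g + 2 \<le> m" "m + n = z + 3 * p + q + g + 1"
        using n z by simp_all
      then have "H m n = (-1) ^ (t * (t - 1) div 2 + (k + 1) * t + u) * int r"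
        using frame[of n 0 t m] tc(2) pu by simp
      moreover have "even (t * (t - 1) div 2 + (k + 1) * t + u)
          \<longleftrightarrow> even (1 + (c + 1) * k + c * (c - 1) div 2)"
        unfolding even_add even_mult_iff Xc even_c gk using odd_p by auto
      ultimately show ?thesis
        by (simp only: minus_one_power_iff)
    qed
    then show ?thesis
      unfolding tc(3,4) c_def[symmetric] by (simp add: power_add)
  qed
  have interior: "H m n = 0"
    if "p < n" "n < 3 * p + q - 1" "\<not> (m + n = z + g + 2 + p \<or> m + n = alpha k i)"
  proof (rule H_interior[OF occ p_def q_def g_def])
    show "n + 1 < 3 * p + q" "m + n \<le> z + 3 * p + q + g"
      using that i z by auto
    show "z + g + 2 + p < m + n"
      using that(3) i(4) z by linarith
  qed (rule that(1))
  show ?thesis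
    unfolding edges unfolding f0 f2 f3 r h_def[symmetric]
  proof (intro conjI impI, goal_cases)
    case 1
    then show ?case by (rule top)
  next
    case 2
    then show ?case by (rule bottom)
  next
    case 3
    then have n: "p < n" "n < 3 * p + q - 1"
      by blast+
    show ?case
    proof (cases "m + n = z + g + 2 + p \<or> m + n = alpha k i")
      case True
      show ?thesis
        unfolding if_P[OF True] by (rule side[OF n True])
    next
      case False
      show ?thesis
        unfolding if_not_P[OF False] by (rule interior[OF n False])
    qed
  qed
qed

end
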